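(* Let $(X,\mathcal P(A),C+\rho\Omega,P)$ be a regularized model with discount factor $\beta\in(0,1)$ (as described in the context), and suppose that the Lipschitz assumption on $(c,p)$ holds. Fix $\mu_{\mathrm{init}}\in\mathcal P(X)$. For every $T\in\mathbb N$ let $Q^T_0\in\mathcal C_\beta$ and $(\pi^T_{-t},\mu^T_{-t})_{t=0}^T\in\mathrm{MFE}_{T,\mu_{\mathrm{init}},Q^T_0}$ be such that $Q^T_0=H_1(Q^T_0,\mu^T_0)$. Let $Q_*$ be an accumulation point of $(Q^T_0)_T$ in $(\mathcal C_\beta,\|\cdot\|_\infty)$. If for any terminal Q-function $Q_{\mathrm{terminal}}\in\mathcal C_\beta$ there exists a unique time-reversed mean-field equilibrium in $\mathrm{TRMFE}_{Q_{\mathrm{terminal}}}$, then any accumulation point (in the weak topology) of $(\pi^T_0\otimes\mu^T_0)_T\subset\mathcal P(X\times\mathcal P(A))$ obtained along a sequence $(T_n)_{n\in\mathbb N}\subset\mathbb N$ with $\lim_{n\to\infty}Q^{T_n}_0=Q_*$ in $(\mathcal C_\beta,\|\cdot\|_\infty)$ induces, after disintegration, a stationary mean-field equilibrium; that is, it can be written as $\pi\otimes\mu$ with $(\pi,\mu)$ a stationary mean-field equilibrium of the regularized model.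
   Context: Setting. $X$ and $A$ are finite nonempty sets with the discrete metric; $\mathcal P(E)$ is the set of probability measures on $E$; $\mathcal P(X)$, $\mathcal P(A)$ carry the norm $\|\cdot\|_1$. $c:X\times A\times\mathcal P(X)\to[0,\infty)$ is a cost function and $p:X\times A\times\mathcal P(X)\to\mathcal P(X)$ a transition kernel. For $u\in\mathcal P(A)$ put $C(x,u,\mu)=\sum_{a}c(x,a,\mu)u(a)$ and $P(\cdot\mid x,u,\mu)=\sum_a p(\cdot\mid x,a,\mu)u(a)$. $\rho>0$ and $\Omega:\mathcal P(A)\to\mathbb R$ is 1-strongly convex for $\|\cdot\|_1$: $\Omega(\theta u+(1-\theta)v)\le\theta\Omega(u)+(1-\theta)\Omega(v)-\frac12\theta(1-\theta)\|u-v\|_1^2$ for $u,v\in\mathcal P(A)$, $\theta\in[0,1]$. Q-functions are functions $Q:X\times\mathcal P(A)\to\mathbb R$. For $Q$ of the form (affine in $u$) $+\rho\Omega(u)$, $Q(x,\cdot)$ is taken to have a unique minimizer $u_Q(x)\in\mathcal P(A)$, and $\pi_Q(\cdot\mid x)=\delta_{u_Q(x)}$. A policy is a kernel $\pi:X\to\mathcal P(\mathcal P(A))$; $\pi\otimes\mu\in\mathcal P(X\times\mathcal P(A))$ denotes $\pi(du\mid x)\mu(dx)$. Operators: $$H_1(Q,\mu)(x,u)=C(x,u,\mu)+\rho\Omega(u)+\beta\sum_{y\in X}\min_{v\in\mathcal P(A)}Q(y,v)\,P(y\mid x,u,\mu),$$ $$H_2(\pi,\mu)(\cdot)=\sum_{x\in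 X}\int_{\mathcal P(A)}P(\cdot\mid x,u,\mu)\,\pi(du\mid x)\,\mu(x).$$ Lipschitz assumption. There are constants $L_1,K_1$ such that for all $x,\hat x,a,\hat a,\mu,\hat\mu$: $|c(x,a,\mu)-c(\hat x,\hat a,\hat\mu)|\le L_1(1_{\{x\ne\hat x\}}+2\cdot 1_{\{a\ne\hat a\}}+\|\mu-\hat\mu\|_1)$ and $\|p(\cdot|x,a,\mu)-p(\cdot|\hat x,\hat a,\hat\mu)\|_1\le K_1(1_{\{x\ne\hat x\}}+2\cdot1_{\{a\ne\hat a\}}+\|\mu-\hat\mu\|_1)$. It is understood that $\beta K_1<2$. Domain. $M:=\sup C$. $\tilde{\mathcal C}_\beta$ is the set of $q:X\times A\to\mathbb R_+$ with $\|q\|_\infty\le\frac{M}{1-\beta}$ and $|q(x,a)-q(\tilde x,\tilde a)|\le\frac{L_1}{1-\beta K_1/2}(1_{\{x\ne\tilde x\}}+2\cdot1_{\{a\ne\tilde a\}})$. $\mathcal C_\beta$ is the set of $Q(x,u)=\sum_a q(x,a)u(a)+\rho\Omega(u)$ with $q\in\tilde{\mathcal C}_\beta$. $\mathrm{TRMFE}_{Q_{\mathrm{terminal}}}$ (time-reversed mean-field equilibria): all families $(\pi_{-t},\mu_{-t})_{t=0}^\infty$ of policies and state measures for which there are Q-functions $(Q_{-t})_{t\ge0}$ with $Q_0=Q_{\mathrm{terminal}}$, $Q_{-t-1}=H_1(Q_{-t},\mu_{-t-1})$, $\mu_{-t}=H_2(\pi_{-t-1},\mu_{-t-1})$ for all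 $t\ge0$, and, for all $t\ge0$ and $x\in X$, $\pi_{-t}(\cdot\mid x)$ supported on the minimizers of $Q_{-t}(x,\cdot)$. $\mathrm{MFE}_{T,\mu_{\mathrm{init}},Q_{\mathrm{terminal}}}$: all families $(\pi_{-t},\mu_{-t})_{t=0}^T$ with $\mu_{-T}=\mu_{\mathrm{init}}$ for which there are Q-functions $(Q_{-t})_{t=0}^T$ with $Q_0=Q_{\mathrm{terminal}}$, $Q_{-t-1}=H_1(Q_{-t},\mu_{-t-1})$, $\mu_{-t}=H_2(\pi_{-t-1},\mu_{-t-1})$ for $0\le t\le T-1$, and $\pi_{-t}(\cdot\mid x)$ supported on the minimizers of $Q_{-t}(x,\cdot)$ for $0\le t\le T$, $x\in X$. Stationary mean-field equilibrium of the regularized ($\beta$-discounted) model: a pair $(\pi,\mu)$ with $\mu=H_2(\pi,\mu)$ and such that the constant policy flow $(\pi,\pi,\dots)$ minimizes, over all admissible policy flows $(\tilde\pi_t)_{t\ge0}$, the discounted cost $E\big[\sum_{t=0}^\infty\beta^t\big(C(x_t,u_t,\mu)+\rho\Omega(u_t)\big)\big]$, where $x_0\sim\mu$, $u_t\sim\tilde\pi_t(\cdot\mid x_t)$, $x_{t+1}\sim P(\cdot\mid x_t,u_t,\mu)$. *)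

theory Defs
  imports "HOL-Probability.Probability"
begin

definition borel_of :: "'b topology \<Rightarrow> 'b measure"
  where "borel_of T = sigma (topspace T) {U. openin T U}"

abbreviation prob_measures :: "'b topology \<Rightarrow> 'b measure set"
  where "prob_measures T \<equiv> space (prob_algebra (borel_of T))"

definition bounded_continuous :: "'b topology \<Rightarrow> ('b \<Rightarrow> real) set"
  where "bounded_continuous T = {f. continuous_map T euclideanreal f \<and> bounded (f ` topspace T)}"

text \<open>The initial topology on the Borel probability measures with respect to all integration
  functionals given by bounded continuous functions.\<close>

definition weak_topology :: "'b topology \<Rightarrow> 'b measure topology"
  where "weak_topology T =
    pullback_topology (prob_measures T)
      (\<lambda>N. \<lambda>f\<in>bounded_continuous T. \<integral>z. f z \<partial>N)
      (product_topology (\<lambda>_. euclideanreal) (bounded_continuous T))"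

definition accumulation_point :: "'b topology \<Rightarrow> (nat \<Rightarrow> 'b) \<Rightarrow> 'b \<Rightarrow> bool"
  where "accumulation_point T s l \<longleftrightarrow>
    l \<in> topspace T \<and> (\<forall>U. openin T U \<and> l \<in> U \<longrightarrow> (\<exists>\<^sub>\<infinity>n. s n \<in> U))"

text \<open>For a finite type \<^typ>\<open>'e\<close>, the set of all probability measures on the discrete space
  \<^typ>\<open>'e\<close> is the type \<^typ>\<open>'e pmf\<close>.\<close>

definition l1_dist :: "'e::finite pmf \<Rightarrow> 'e pmf \<Rightarrow> real"
  where "l1_dist u v = (\<Sum>e\<in>UNIV. \<bar>pmf u e - pmf v e\<bar>)"

lemma Metric_space_l1_dist: "Metric_space UNIV l1_dist"
proof
  fix u v w :: "'e::finite pmf"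
  show "0 \<le> l1_dist u v"
    by (simp add: l1_dist_def sum_nonneg)
  show "l1_dist u v = l1_dist v u"
    by (simp add: l1_dist_def abs_minus_commute)
  show "l1_dist u v = 0 \<longleftrightarrow> u = v"
    by (auto simp: l1_dist_def sum_nonneg_eq_0_iff intro: pmf_eqI)
  show "l1_dist u w \<le> l1_dist u v + l1_dist v w"
    unfolding l1_dist_def sum.distrib[symmetric] by (rule sum_mono) linarith
qed

definition l1_topology :: "'e::finite pmf topology"
  where "l1_topology = Metric_space.mtopology UNIV l1_dist"

definition l1_strongly_convex :: "('a::finite pmf \<Rightarrow> real) \<Rightarrow> bool"
  where "l1_strongly_convex \<Omega> \<longleftrightarrow>
    (\<forall>u v w. \<forall>\<theta>\<in>{0..1}. (\<forall>a. pmf w a = \<theta> * pmf u a + (1 - \<theta>) * pmf v a) \<longrightarrow>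
      \<Omega> w \<le> \<theta> * \<Omega> u + (1 - \<theta>) * \<Omega> v - 1/2 * \<theta> * (1 - \<theta>) * (l1_dist u v)\<^sup>2)"

type_synonym ('x, 'a) cost = "'x \<Rightarrow> 'a \<Rightarrow> 'x pmf \<Rightarrow> real"
type_synonym ('x, 'a) kernel = "'x \<Rightarrow> 'a \<Rightarrow> 'x pmf \<Rightarrow> 'x pmf"
type_synonym ('x, 'a) qfun = "'x \<Rightarrow> 'a pmf \<Rightarrow> real"
type_synonym ('x, 'a) policy = "'x \<Rightarrow> 'a pmf measure"

definition lipschitz_model ::
    "('x::finite, 'a::finite) cost \<Rightarrow> ('x, 'a) kernel \<Rightarrow> real \<Rightarrow> real \<Rightarrow> bool"
  where "lipschitz_model c p L K \<longleftrightarrow>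
    (\<forall>x x' a a' \<mu> \<mu>'.
      \<bar>c x a \<mu> - c x' a' \<mu>'\<bar> \<le> L * (of_bool (x \<noteq> x') + 2 * of_bool (a \<noteq> a') + l1_dist \<mu> \<mu>') \<and>
      l1_dist (p x a \<mu>) (p x' a' \<mu>') \<le> K * (of_bool (x \<noteq> x') + 2 * of_bool (a \<noteq> a') + l1_dist \<mu> \<mu>'))"

definition mean_cost :: "('x::finite, 'a::finite) cost \<Rightarrow> 'x \<Rightarrow> 'a pmf \<Rightarrow> 'x pmf \<Rightarrow> real"
  where "mean_cost c x u \<mu> = (\<Sum>a\<in>UNIV. c x a \<mu> * pmf u a)"

definition mean_kernel :: "('x::finite, 'a::finite) kernel \<Rightarrow> 'x \<Rightarrow> 'a pmf \<Rightarrow> 'x pmf \<Rightarrow> 'x pmf"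
  where "mean_kernel p x u \<mu> = bind_pmf u (\<lambda>a. p x a \<mu>)"

lemma pmf_mean_kernel:
  "pmf (mean_kernel p x u \<mu>) y = (\<Sum>a\<in>UNIV. pmf (p x a \<mu>) y * pmf u a)"
  unfolding mean_kernel_def pmf_bind
  by (subst integral_measure_pmf[where A = UNIV]) (auto simp: mult.commute)

definition is_policy :: "('x, 'a::finite) policy \<Rightarrow> bool"
  where "is_policy \<pi> \<longleftrightarrow> (\<forall>x. \<pi> x \<in> prob_measures l1_topology)"

definition state_action_topology :: "('x \<times> 'a::finite pmf) topology"
  where "state_action_topology = prod_topology (discrete_topology UNIV) l1_topology"

text \<open>The measure $\pi(du \mid x)\,\mu(dx)$.\<close>

definition joint_law :: "('x::finite, 'a::finite) policy \<Rightarrow> 'x pmf \<Rightarrow> ('x \<times> 'a pmf) measure"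
  where "joint_law \<pi> \<mu> =
    measure_pmf \<mu> \<bind> (\<lambda>x. distr (\<pi> x) (borel_of state_action_topology) (Pair x))"

definition H1 :: "('x::finite, 'a::finite) cost \<Rightarrow> ('x, 'a) kernel \<Rightarrow> ('a pmf \<Rightarrow> real) \<Rightarrow>
    real \<Rightarrow> real \<Rightarrow> ('x, 'a) qfun \<Rightarrow> 'x pmf \<Rightarrow> ('x, 'a) qfun"
  where "H1 c p \<Omega> \<rho> \<beta> Q \<mu> = (\<lambda>x u. mean_cost c x u \<mu> + \<rho> * \<Omega> u
    + \<beta> * (\<Sum>y\<in>UNIV. (INF v. Q y v) * pmf (mean_kernel p x u \<mu>) y))"

definition H2 :: "('x::finite, 'a::finite) kernel \<Rightarrow> ('x, 'a) policy \<Rightarrow> 'x pmf \<Rightarrow> 'x pmf"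
  where "H2 p \<pi> \<mu> =
    embed_pmf (\<lambda>y. \<Sum>x\<in>UNIV. (\<integral>u. pmf (mean_kernel p x u \<mu>) y \<partial>\<pi> x) * pmf \<mu> x)"

definition C_tilde :: "('x::finite, 'a::finite) cost \<Rightarrow> real \<Rightarrow> real \<Rightarrow> real \<Rightarrow> ('x \<Rightarrow> 'a \<Rightarrow> real) set"
  where "C_tilde c \<beta> L K = {q.
    (\<forall>x a. 0 \<le> q x a \<and> q x a \<le> (SUP (x, u, \<mu>)\<in>UNIV. mean_cost c x u \<mu>) / (1 - \<beta>)) \<and>
    (\<forall>x x' a a'. \<bar>q x a - q x' a'\<bar> \<le>
       L / (1 - \<beta> * K / 2) * (of_bool (x \<noteq> x') + 2 * of_bool (a \<noteq> a')))}"

definition C_space :: "('x::finite, 'a::finite) cost \<Rightarrow> ('a pmf \<Rightarrow> real) \<Rightarrow>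
    real \<Rightarrow> real \<Rightarrow> real \<Rightarrow> real \<Rightarrow> ('x, 'a) qfun set"
  where "C_space c \<Omega> \<rho> \<beta> L K =
    {\<lambda>x u. (\<Sum>a\<in>UNIV. q x a * pmf u a) + \<rho> * \<Omega> u | q. q \<in> C_tilde c \<beta> L K}"

text \<open>Two elements of \<^const>\<open>C_space\<close> differ by a bounded function, even where they are themselves
  unbounded, so on \<^const>\<open>C_space\<close> the first branch below applies. The other branch is there
  because the locale \<^locale>\<open>Metric_space\<close> asks for nonnegativity also off the carrier.\<close>

definition sup_dist :: "('x, 'a) qfun \<Rightarrow> ('x, 'a) qfun \<Rightarrow> real"
  where "sup_dist Q Q' =
    (if bdd_above (range (\<lambda>(x, u). \<bar>Q x u - Q' x u\<bar>))
     then SUP (x, u)\<in>UNIV. \<bar>Q x u - Q' x u\<bar> else 0)"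

lemma C_space_diff_bounded:
  fixes Q :: "('x::finite, 'a::finite) qfun"
  assumes "Q \<in> C_space c \<Omega> \<rho> \<beta> L K" "Q' \<in> C_space c \<Omega> \<rho> \<beta> L K"
  shows "bdd_above (range (\<lambda>(x, u). \<bar>Q x u - Q' x u\<bar>))"
proof -
  from assms obtain q q' where
    Q: "Q = (\<lambda>x u. (\<Sum>a\<in>UNIV. q x a * pmf u a) + \<rho> * \<Omega> u)" and
    Q': "Q' = (\<lambda>x u. (\<Sum>a\<in>UNIV. q' x a * pmf u a) + \<rho> * \<Omega> u)"
    unfolding C_space_def by blast
  have "\<bar>Q x u - Q' x u\<bar> \<le> (\<Sum>z\<in>UNIV. \<Sum>a\<in>UNIV. \<bar>q z a - q' z a\<bar>)" for x u
  proof -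
    have "\<bar>Q x u - Q' x u\<bar> = \<bar>\<Sum>a\<in>UNIV. (q x a - q' x a) * pmf u a\<bar>"
      by (simp add: Q Q' algebra_simps sum_subtractf)
    also have "\<dots> \<le> (\<Sum>a\<in>UNIV. \<bar>(q x a - q' x a) * pmf u a\<bar>)"
      by (rule sum_abs)
    also have "\<dots> \<le> (\<Sum>a\<in>UNIV. \<bar>q x a - q' x a\<bar>)"
      by (intro sum_mono) (simp add: abs_mult mult_left_le pmf_le_1)
    also have "\<dots> \<le> (\<Sum>z\<in>UNIV. \<Sum>a\<in>UNIV. \<bar>q z a - q' z a\<bar>)"
      by (rule member_le_sum[where f = "\<lambda>z. \<Sum>a\<in>UNIV. \<bar>q z a - q' z a\<bar>"])
        (auto intro: sum_nonneg)
    finally show ?thesis .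
  qed
  then show ?thesis
    by (auto intro!: bdd_aboveI)
qed

lemma Metric_space_C_space:
  fixes c :: "('x::finite, 'a::finite) cost"
  shows "Metric_space (C_space c \<Omega> \<rho> \<beta> L K) sup_dist"
proof -
  let ?C = "C_space c \<Omega> \<rho> \<beta> L K"
  have upper: "\<bar>Q x u - Q' x u\<bar> \<le> sup_dist Q Q'"
    if "bdd_above (range (\<lambda>(x, u). \<bar>Q x u - Q' x u\<bar>))" for Q Q' :: "('x, 'a) qfun" and x u
    using cSUP_upper[OF UNIV_I that, of "(x, u)"] that by (simp add: sup_dist_def)
  have least: "sup_dist Q Q' \<le> B" if "\<And>x u. \<bar>Q x u - Q' x u\<bar> \<le> B" "0 \<le> B"
    for Q Q' :: "('x, 'a) qfun" and B
    unfolding sup_dist_def using that by (auto intro!: cSUP_least)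
  have nonneg: "0 \<le> sup_dist Q Q'" for Q Q' :: "('x, 'a) qfun"
  proof (cases "bdd_above (range (\<lambda>(x, u). \<bar>Q x u - Q' x u\<bar>))")
    case True
    show ?thesis
      by (rule order_trans[OF abs_ge_zero upper[OF True]])
  next
    case False
    then show ?thesis
      unfolding sup_dist_def by (simp only: if_False order_refl)
  qed
  show ?thesis
  proof
    fix Q R S :: "('x, 'a) qfun"
    show "0 \<le> sup_dist Q R"
      by (rule nonneg)
    show "sup_dist Q R = sup_dist R Q"
      by (simp add: sup_dist_def abs_minus_commute)
    show "sup_dist Q R = 0 \<longleftrightarrow> Q = R" if "Q \<in> ?C" "R \<in> ?C"
    proof
      assume "sup_dist Q R = 0"
      then have "\<bar>Q x u - R x u\<bar> \<le> 0" for x u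
        using upper[OF C_space_diff_bounded[OF that], of x u] by simp
      then show "Q = R"
        by (intro ext) simp
    next
      assume "Q = R"
      then have "sup_dist Q R \<le> 0"
        by (intro least) simp_all
      then show "sup_dist Q R = 0"
        using nonneg[of Q R] by simp
    qed
    show "sup_dist Q S \<le> sup_dist Q R + sup_dist R S" if "Q \<in> ?C" "R \<in> ?C" "S \<in> ?C"
    proof (rule least)
      fix x u
      show "\<bar>Q x u - S x u\<bar> \<le> sup_dist Q R + sup_dist R S"
        using upper[OF C_space_diff_bounded[OF that(1,2)], of x u]
          upper[OF C_space_diff_bounded[OF that(2,3)], of x u] by linarith
    next
      show "0 \<le> sup_dist Q R + sup_dist R S"
        using nonneg[of Q R] nonneg[of R S] by simp
    qed
  qed
qed

definition C_topology :: "('x::finite, 'a::finite) cost \<Rightarrow> ('a pmf \<Rightarrow> real) \<Rightarrow>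
    real \<Rightarrow> real \<Rightarrow> real \<Rightarrow> real \<Rightarrow> ('x, 'a) qfun topology"
  where "C_topology c \<Omega> \<rho> \<beta> L K = Metric_space.mtopology (C_space c \<Omega> \<rho> \<beta> L K) sup_dist"

definition greedy :: "('x, 'a::finite) policy \<Rightarrow> ('x, 'a) qfun \<Rightarrow> bool"
  where "greedy \<pi> Q \<longleftrightarrow> (\<forall>x. AE u in \<pi> x. is_arg_min (Q x) (\<lambda>_. True) u)"

text \<open>Index \<open>t\<close> of the sequences below stands for time $-t$.\<close>

definition TRMFE :: "('x::finite, 'a::finite) cost \<Rightarrow> ('x, 'a) kernel \<Rightarrow> ('a pmf \<Rightarrow> real) \<Rightarrow>
    real \<Rightarrow> real \<Rightarrow> ('x, 'a) qfun \<Rightarrow> ((nat \<Rightarrow> ('x, 'a) policy) \<times> (nat \<Rightarrow> 'x pmf)) set"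
  where "TRMFE c p \<Omega> \<rho> \<beta> Qterm = {(\<pi>, \<mu>).
    (\<forall>t. is_policy (\<pi> t)) \<and>
    (\<exists>Q. Q 0 = Qterm \<and>
      (\<forall>t. Q (Suc t) = H1 c p \<Omega> \<rho> \<beta> (Q t) (\<mu> (Suc t)) \<and>
           \<mu> t = H2 p (\<pi> (Suc t)) (\<mu> (Suc t))) \<and>
      (\<forall>t. greedy (\<pi> t) (Q t)))}"

text \<open>The values at indices \<open>t > T\<close> are irrelevant here.\<close>

definition MFE :: "('x::finite, 'a::finite) cost \<Rightarrow> ('x, 'a) kernel \<Rightarrow> ('a pmf \<Rightarrow> real) \<Rightarrow>
    real \<Rightarrow> real \<Rightarrow> nat \<Rightarrow> 'x pmf \<Rightarrow> ('x, 'a) qfun \<Rightarrow>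
    ((nat \<Rightarrow> ('x, 'a) policy) \<times> (nat \<Rightarrow> 'x pmf)) set"
  where "MFE c p \<Omega> \<rho> \<beta> T \<mu>init Qterm = {(\<pi>, \<mu>).
    (\<forall>t\<le>T. is_policy (\<pi> t)) \<and> \<mu> T = \<mu>init \<and>
    (\<exists>Q. Q 0 = Qterm \<and>
      (\<forall>t<T. Q (Suc t) = H1 c p \<Omega> \<rho> \<beta> (Q t) (\<mu> (Suc t)) \<and>
             \<mu> t = H2 p (\<pi> (Suc t)) (\<mu> (Suc t))) \<and>
      (\<forall>t\<le>T. greedy (\<pi> t) (Q t)))}"

text \<open>Conditional law of $(x_t, u_t)$ given the history \<open>\<omega>\<close> of state-action pairs before \<open>t\<close>, when
  $x_0 \sim \mu$ and the mean-field argument of the transition kernel is frozen at \<open>\<mu>\<close>.\<close>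

definition step_law :: "('x::finite, 'a::finite) kernel \<Rightarrow> 'x pmf \<Rightarrow> (nat \<Rightarrow> ('x, 'a) policy) \<Rightarrow>
    nat \<Rightarrow> (nat \<Rightarrow> 'x \<times> 'a pmf) \<Rightarrow> ('x \<times> 'a pmf) measure"
  where "step_law p \<mu> \<pi> t \<omega> = joint_law (\<pi> t)
    (if t = 0 then \<mu> else mean_kernel p (fst (\<omega> (t - 1))) (snd (\<omega> (t - 1))) \<mu>)"

text \<open>Law of the trajectory $(x_t, u_t)_{t \ge 0}$, obtained from the Ionescu-Tulcea theorem.\<close>

definition trajectory_law :: "('x::finite, 'a::finite) kernel \<Rightarrow> 'x pmf \<Rightarrow>
    (nat \<Rightarrow> ('x, 'a) policy) \<Rightarrow> (nat \<Rightarrow> 'x \<times> 'a pmf) measure"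
  where "trajectory_law p \<mu> \<pi> =
    projective_family.lim UNIV
      (Ionescu_Tulcea.CI (step_law p \<mu> \<pi>) (\<lambda>_. borel_of state_action_topology))
      (\<lambda>_. borel_of state_action_topology)"

definition discounted_cost :: "('x::finite, 'a::finite) cost \<Rightarrow> ('x, 'a) kernel \<Rightarrow>
    ('a pmf \<Rightarrow> real) \<Rightarrow> real \<Rightarrow> real \<Rightarrow> 'x pmf \<Rightarrow> (nat \<Rightarrow> ('x, 'a) policy) \<Rightarrow> real"
  where "discounted_cost c p \<Omega> \<rho> \<beta> \<mu> \<pi> =
    (\<integral>\<omega>. (\<Sum>t. \<beta> ^ t * (mean_cost c (fst (\<omega> t)) (snd (\<omega> t)) \<mu> + \<rho> * \<Omega> (snd (\<omega> t))))
      \<partial>trajectory_law p \<mu> \<pi>)"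

definition stationary_MFE :: "('x::finite, 'a::finite) cost \<Rightarrow> ('x, 'a) kernel \<Rightarrow>
    ('a pmf \<Rightarrow> real) \<Rightarrow> real \<Rightarrow> real \<Rightarrow> ('x, 'a) policy \<Rightarrow> 'x pmf \<Rightarrow> bool"
  where "stationary_MFE c p \<Omega> \<rho> \<beta> \<pi> \<mu> \<longleftrightarrow>
    is_policy \<pi> \<and> \<mu> = H2 p \<pi> \<mu> \<and>
    (\<forall>\<pi>'. (\<forall>t. is_policy (\<pi>' t)) \<longrightarrow>
      discounted_cost c p \<Omega> \<rho> \<beta> \<mu> (\<lambda>_. \<pi>) \<le> discounted_cost c p \<Omega> \<rho> \<beta> \<mu> \<pi>')"

end

theory Submission
  imports Defs
begin

text \<open>Strong convexity makes the minimizer of $w \cdot u + \rho\Omega(u)$ Lipschitz in $w$, so that the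
  backward recursion for the Q-functions and the forward recursion for the state measures are
  continuous. By compactness, a subsequence of the finite-horizon equilibria converges at all times to
  a time-reversed equilibrium with terminal function $Q_*$, and $Q_* = H_1(Q_*, \mu_0)$ in the limit.
  Because of this fixed-point equation, prolonging the limit by one more step of its time-$0$ dynamics
  and shifting time gives again a time-reversed equilibrium with terminal function $Q_*$. Uniqueness
  then yields $\mu_0 = H_2(\pi_0, \mu_0)$. That the greedy policy for the fixed point $Q_*$ is optimal
  follows by telescoping: the discounted cost of any policy flow is the value of $Q_*$ plus the
  discounted sum of the expected gaps $Q_*(x_t, u_t) - \min_v Q_*(x_t, v) \ge 0$.\<close>

subsection \<open>Borel structure on the simplex\<close>

text \<open>The Q-functions that occur are all of the form \<open>reg (q x)\<close> with a finite
  table \<open>q\<close>, since \<open>H1\<close> preserves this form, and the only greedy policy of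
  such a function is the Dirac policy \<open>det_policy q\<close>. The flows are therefore
  recursions in finitely many real numbers per time, and limits can be taken entry by entry, without
  a topology on policies. The initial measure sits at time -T and recedes to infinity, so the limit
  inherits no initial condition; this is why equilibria with an infinite past, and their uniqueness,
  decide the matter. Two points lie outside this reduction. \<Omega> is only assumed strongly convex
  with attained minima, so the measurability and boundedness on which the expected cost relies must
  be extracted from convexity. And a weak accumulation point is a priori an arbitrary measure: it is
  recognized as a joint law by finitely many test functions, namely the indicators of the states and
  the distance of the action to the limiting minimizer.\<close>

lemma space_borel_of [simp]: "space (borel_of T) = topspace T"
  by (simp add: borel_of_def space_measure_of_conv)

lemma sets_borel_of: "sets (borel_of T) = sigma_sets (topspace T) {U. openin T U}"
  unfolding borel_of_def by (rule sets_measure_of) (auto dest: openin_subset)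

lemma openin_in_sets_borel_of: "openin T U \<Longrightarrow> U \<in> sets (borel_of T)"
  by (auto simp: sets_borel_of)

lemma closedin_in_sets_borel_of: "closedin T C \<Longrightarrow> C \<in> sets (borel_of T)"
proof -
  assume C: "closedin T C"
  then have "topspace T - C \<in> sets (borel_of T)"
    by (intro openin_in_sets_borel_of) (auto simp: closedin_def)
  then have "space (borel_of T) - (topspace T - C) \<in> sets (borel_of T)"
    by (rule sets.compl_sets)
  moreover have "space (borel_of T) - (topspace T - C) = C"
    using closedin_subset[OF C] by auto
  ultimately show ?thesis by simp
qed

lemma continuous_map_measurable_borel_of:
  assumes "continuous_map T U f"
  shows "f \<in> borel_of T \<rightarrow>\<^sub>M borel_of U"
proof (rule measurable_sigma_sets[OF sets_borel_of])
  show "{V. openin U V} \<subseteq> Pow (topspace U)"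
    by (auto dest: openin_subset)
  show "f \<in> space (borel_of T) \<rightarrow> topspace U"
    using continuous_map_funspace[OF assms] by simp
  fix V assume "V \<in> {V. openin U V}"
  then have "openin T {x \<in> topspace T. f x \<in> V}"
    using assms by (auto simp: continuous_map_def)
  also have "{x \<in> topspace T. f x \<in> V} = f -` V \<inter> space (borel_of T)"
    by auto
  finally show "f -` V \<inter> space (borel_of T) \<in> sets (borel_of T)"
    by (rule openin_in_sets_borel_of)
qed

lemma continuous_map_borel_measurable:
  assumes "continuous_map T euclidean f"
  shows "f \<in> borel_measurable (borel_of T)"
proof (rule borel_measurableI)
  fix S :: "'b set" assume "open S"
  then have "openin T {x \<in> topspace T. f x \<in> S}"
    using assms by (auto simp: continuous_map_def)
  also have "{x \<in> topspace T. f x \<in> S} = f -` S \<inter> space (borel_of T)"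
    by auto
  finally show "f -` S \<inter> space (borel_of T) \<in> sets (borel_of T)"
    by (rule openin_in_sets_borel_of)
qed

lemma in_prob_measuresD:
  assumes "N \<in> prob_measures T"
  shows "prob_space N" "sets N = sets (borel_of T)" "space N = topspace T"
  using assms sets_eq_imp_space_eq[of N "borel_of T"] by (auto simp: space_prob_algebra)

interpretation l1: Metric_space UNIV l1_dist
  by (rule Metric_space_l1_dist)

lemma topspace_l1_topology [simp]: "topspace l1_topology = UNIV"
  by (simp add: l1_topology_def)

lemma abs_pmf_diff_le_l1_dist: "\<bar>pmf u a - pmf v a\<bar> \<le> l1_dist u v"
  unfolding l1_dist_def by (rule member_le_sum) auto

lemma lipschitz_continuous_map_l1:
  assumes "\<And>u v. \<bar>f u - f v\<bar> \<le> B * l1_dist u v"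
  shows "continuous_map l1_topology euclideanreal f"
proof -
  have "Lipschitz_continuous_map (metric (UNIV, l1_dist)) (metric (UNIV, dist)) f"
    unfolding Lipschitz_continuous_map_def
    using assms by (auto simp: l1.Metric_space_axioms Met_TC.Metric_space_axioms dist_real_def)
  then have "continuous_map (mtopology_of (metric (UNIV, l1_dist)))
      (mtopology_of (metric (UNIV, dist))) f"
    by (rule Lipschitz_continuous_imp_continuous_map)
  then show ?thesis
    by (simp add: l1_topology_def mtopology_of_def l1.Metric_space_axioms Met_TC.Metric_space_axioms)
qed

lemma continuous_map_l1_pmf: "continuous_map l1_topology euclideanreal (\<lambda>u. pmf u a)"
  using abs_pmf_diff_le_l1_dist by (intro lipschitz_continuous_map_l1[where B = 1]) simp

lemma continuous_map_l1_dist: "continuous_map l1_topology euclideanreal (\<lambda>u. l1_dist u v)"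
proof (rule lipschitz_continuous_map_l1[where B = 1])
  fix u w
  show "\<bar>l1_dist u v - l1_dist w v\<bar> \<le> 1 * l1_dist u w"
    using l1.triangle[of u w v] l1.triangle[of w u v] by (simp add: l1.commute)
qed

lemma singleton_in_sets_l1: "{u} \<in> sets (borel_of l1_topology)"
  by (rule closedin_in_sets_borel_of) (simp add: l1_topology_def closedin_Hausdorff_sing_eq l1.Hausdorff_space_mtopology)

lemma topspace_state_action [simp]: "topspace state_action_topology = UNIV"
  by (simp add: state_action_topology_def)

lemma continuous_map_Pair_state_action:
  "continuous_map l1_topology state_action_topology (Pair x)"
  unfolding state_action_topology_def continuous_map_pairwise o_def by simp

text \<open>The state component is discrete, so every slice \<open>{x} \<times> U\<close> with
  \<open>U\<close> open is open, and continuity can be checked one state at a time.\<close>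

lemma continuous_map_state_action:
  fixes f :: "'x \<times> 'a::finite pmf \<Rightarrow> 'b::topological_space"
  assumes "\<And>x. continuous_map l1_topology euclidean (\<lambda>u. f (x, u))"
  shows "continuous_map state_action_topology euclidean f"
  unfolding continuous_map_def
proof (intro conjI allI impI)
  fix U :: "'b set" assume "openin euclidean U"
  then have "openin l1_topology {u. f (x, u) \<in> U}" for x
    using assms[of x] by (simp add: continuous_map_def)
  then have "openin state_action_topology (\<Union>x. {x} \<times> {u. f (x, u) \<in> U})"
    unfolding state_action_topology_def by (intro openin_Union) (auto simp: openin_prod_Times_iff)
  also have "(\<Union>x. {x} \<times> {u. f (x, u) \<in> U}) = {z. f z \<in> U}"
    by auto
  finally show "openin state_action_topology {z \<in> topspace state_action_topology. f z \<in> U}"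
    by simp
qed simp

lemma measurable_fst_state_action [measurable]:
  "(fst :: 'x \<times> 'b::finite pmf \<Rightarrow> 'x) \<in> borel_of state_action_topology \<rightarrow>\<^sub>M count_space UNIV"
proof -
  have "openin state_action_topology (A \<times> (UNIV :: 'b pmf set))" for A :: "'x set"
    using openin_topspace[of "l1_topology :: 'b pmf topology"]
    unfolding state_action_topology_def by (simp add: openin_prod_Times_iff del: openin_topspace)
  then have "openin state_action_topology ((fst -` A) :: ('x \<times> 'b pmf) set)" for A :: "'x set"
    by (simp add: vimage_fst)
  then show ?thesis
    by (intro measurableI) (auto intro: openin_in_sets_borel_of)
qed

lemma measurable_snd_state_action [measurable]:
  "snd \<in> borel_of state_action_topology \<rightarrow>\<^sub>M borel_of l1_topology"
  unfolding state_action_topology_def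
  by (intro continuous_map_measurable_borel_of continuous_map_snd)

lemma measurable_Pair_state_action [measurable]:
  "Pair x \<in> borel_of l1_topology \<rightarrow>\<^sub>M borel_of state_action_topology"
  by (intro continuous_map_measurable_borel_of continuous_map_Pair_state_action)

text \<open>With finitely many states, \<open>f\<close> is a choice, measurable through
  \<open>fst\<close>, among functions of \<open>snd\<close>.\<close>

lemma borel_measurable_state_action:
  fixes f :: "'x::finite \<times> 'a::finite pmf \<Rightarrow> 'b::topological_space"
  assumes "\<And>x. (\<lambda>u. f (x, u)) \<in> borel_measurable (borel_of l1_topology)"
  shows "f \<in> borel_measurable (borel_of state_action_topology)"
proof -
  have "(\<lambda>z. f (x, snd z)) \<in> borel_measurable (borel_of state_action_topology)" for x
    by (rule measurable_compose[OF measurable_snd_state_action assms])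
  then have "(\<lambda>z. f (fst z, snd z)) \<in> borel_measurable (borel_of state_action_topology)"
    by (rule measurable_compose_countable[where f = "\<lambda>x z. f (x, snd z)", OF _ measurable_fst_state_action])
  then show ?thesis by simp
qed

lemma borel_measurable_l1_pmf [measurable]:
  "(\<lambda>u. pmf u a) \<in> borel_measurable (borel_of l1_topology)"
  by (intro continuous_map_borel_measurable continuous_map_l1_pmf)

section \<open>Mixtures and convex functions on the simplex\<close>

lemma pmf_mix_ex:
  assumes "0 \<le> t" "t \<le> 1"
  obtains w where "\<And>a. pmf w a = t * pmf u a + (1 - t) * pmf v a"
proof
  show "pmf (bind_pmf (bernoulli_pmf t) (\<lambda>b. if b then u else v)) a = t * pmf u a + (1 - t) * pmf v a"
    for a using assms by (simp add: pmf_bind)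
qed

text \<open>Mixing is undone: domination makes the remainder of \<open>v\<close> after removal of
  \<open>t * u\<close> nonnegative, its total mass is \<open>1 - t\<close>, and rescaling makes it a
  probability vector.\<close>

lemma pmf_extract:
  fixes u v :: "'a::finite pmf"
  assumes t: "0 \<le> t" "t < 1" and le: "\<And>a. t * pmf u a \<le> pmf v a"
  obtains w where "\<And>a. pmf v a = t * pmf u a + (1 - t) * pmf w a"
proof -
  let ?f = "\<lambda>a. (pmf v a - t * pmf u a) / (1 - t)"
  have nn: "0 \<le> ?f a" for a
    using t le[of a] by simp
  have "(\<Sum>a\<in>UNIV. ?f a) = ((\<Sum>a\<in>UNIV. pmf v a) - t * (\<Sum>a\<in>UNIV. pmf u a)) / (1 - t)"
    by (simp add: sum_divide_distrib[symmetric] sum_subtractf sum_distrib_left)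
  also have "\<dots> = 1"
    using t by (simp add: sum_pmf_eq_1)
  finally have "(\<integral>\<^sup>+a. ennreal (?f a) \<partial>count_space UNIV) = 1"
    by (simp add: nn_integral_count_space_finite sum_ennreal nn)
  then have "pmf (embed_pmf ?f) a = ?f a" for a
    by (intro pmf_embed_pmf nn)
  then show thesis
    using t by (intro that[of "embed_pmf ?f"]) (simp add: field_simps)
qed

text \<open>Encoded as in \<open>l1_strongly_convex\<close>, through a third measure
  \<open>w\<close> given by its point masses, so that convexity of \<Omega> results from dropping
  the quadratic term.\<close>

definition pmf_convex :: "('a::finite pmf \<Rightarrow> real) \<Rightarrow> bool"
  where "pmf_convex F \<longleftrightarrow> (\<forall>u v w. \<forall>t\<in>{0..1}. (\<forall>a. pmf w a = t * pmf u a + (1 - t) * pmf v a) \<longrightarrow>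
    F w \<le> t * F u + (1 - t) * F v)"

lemma pmf_convexD:
  "pmf_convex F \<Longrightarrow> 0 \<le> t \<Longrightarrow> t \<le> 1 \<Longrightarrow> (\<And>a. pmf w a = t * pmf u a + (1 - t) * pmf v a) \<Longrightarrow>
    F w \<le> t * F u + (1 - t) * F v"
  unfolding pmf_convex_def by auto

text \<open>Induction on the size of the support: \<open>u\<close> is a mixture of the vertex at one
  of its atoms \<open>a\<close>, taken with the whole weight \<open>pmf u a\<close>, and of some
  \<open>w\<close> that no longer charges \<open>a\<close>.\<close>

lemma pmf_convex_le_vertices:
  fixes F :: "'a::finite pmf \<Rightarrow> real"
  assumes F: "pmf_convex F" and B: "\<And>a. F (return_pmf a) \<le> B"
  shows "F u \<le> B"
proof (induction "card (set_pmf u)" arbitrary: u rule: less_induct)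
  case less
  obtain a where a: "a \<in> set_pmf u"
    using set_pmf_not_empty[of u] by auto
  show ?case
  proof (cases "pmf u a = 1")
    case True
    then have "measure (measure_pmf u) {a} = 1"
      by (simp add: measure_pmf_single)
    then have "set_pmf u \<subseteq> {a}"
      by (auto simp: measure_pmf.prob_eq_1 AE_measure_pmf_iff)
    then show ?thesis
      using B by (simp add: set_pmf_subset_singleton)
  next
    case False
    then have lt: "pmf u a < 1"
      using pmf_le_1[of u a] by simp
    have le: "pmf u a * pmf (return_pmf a) b \<le> pmf u b" for b
      by (cases "b = a") auto
    obtain w where w: "\<And>b. pmf u b = pmf u a * pmf (return_pmf a) b + (1 - pmf u a) * pmf w b"
      using pmf_extract[OF pmf_nonneg lt le] by blast
    have "pmf w a = 0"
      using w[of a] lt by simp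
    moreover have "pmf w b = 0" if "pmf u b = 0" for b
      using w[of b] lt that a by (cases "b = a") (auto simp: set_pmf_iff)
    ultimately have "set_pmf w \<subset> set_pmf u"
      using a by (auto simp: set_pmf_iff)
    then have "F w \<le> B"
      by (intro less.hyps psubset_card_mono) auto
    have "F u \<le> pmf u a * F (return_pmf a) + (1 - pmf u a) * F w"
      by (rule pmf_convexD[OF F pmf_nonneg pmf_le_1 w])
    also have "\<dots> \<le> pmf u a * B + (1 - pmf u a) * B"
      using lt B \<open>F w \<le> B\<close> by (intro add_mono mult_left_mono) auto
    finally show ?thesis
      by (simp add: algebra_simps)
  qed
qed


text \<open>A convex function on the simplex may jump up at the boundary, but it is upper semicontinuous:
  a point $v$ close to $u$ is $t u + (1 - t) w$ for some $w$ in the simplex, with $t$ close to $1$.\<close>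

lemma pmf_convex_borel_measurable:
  fixes F :: "'a::finite pmf \<Rightarrow> real"
  assumes F: "pmf_convex F"
  shows "F \<in> borel_measurable (borel_of l1_topology)"
proof -
  define B where "B = Max (range (\<lambda>a. F (return_pmf a)))"
  have B: "F u \<le> B" for u
    unfolding B_def by (rule pmf_convex_le_vertices[OF F]) simp
  have "openin l1_topology {u. F u < r}" for r
  proof -
    have "\<exists>e>0. l1.mball u e \<subseteq> {u. F u < r}" if u: "F u < r" for u
    proof -
      \<comment> \<open>As \<open>t\<close> tends to 1 from the left the bound tends to
        \<open>F u\<close>, which lies below \<open>r\<close>; \<open>B\<close> stands in for the
        uncontrolled value \<open>F w\<close>.\<close>
      obtain t where t: "0 < t" "t < 1" "t * F u + (1 - t) * B < r"
      proof -
        have "((\<lambda>t. t * F u + (1 - t) * B) \<longlongrightarrow> 1 * F u + (1 - 1) * B) (at_left 1)"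
          by (intro tendsto_intros)
        then have "\<forall>\<^sub>F t in at_left 1. t * F u + (1 - t) * B < r"
          using u by (auto dest: order_tendstoD(2))
        moreover have "\<forall>\<^sub>F t in at_left (1::real). 0 < t"
          by (rule eventually_at_leftI[of 0]) auto
        moreover have "\<forall>\<^sub>F t in at_left (1::real). t < 1"
          by (simp add: eventually_at_filter)
        ultimately have "\<forall>\<^sub>F t in at_left (1::real). 0 < t \<and> t < 1 \<and> t * F u + (1 - t) * B < r"
          by eventually_elim simp
        then show thesis
          using that eventually_happens'[OF trivial_limit_at_left_real] by blast
      qed
      \<comment> \<open>The radius \<open>(1 - t) * m\<close> keeps the loss of mass at each atom of
        \<open>u\<close> within \<open>(1 - t) * pmf u a\<close>, which is the domination that
        \<open>pmf_extract\<close> asks for.\<close>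
      define m where "m = Min (pmf u ` set_pmf u)"
      have m: "0 < m" "\<And>a. a \<in> set_pmf u \<Longrightarrow> m \<le> pmf u a"
        unfolding m_def by (auto simp: pmf_positive set_pmf_not_empty)
      have "F v < r" if v: "l1_dist u v < (1 - t) * m" for v
      proof -
        have le: "t * pmf u a \<le> pmf v a" for a
        proof (cases "a \<in> set_pmf u")
          case True
          have "pmf u a - pmf v a \<le> (1 - t) * m"
            using v abs_pmf_diff_le_l1_dist[of u a v] by linarith
          also have "\<dots> \<le> (1 - t) * pmf u a"
            using m(2)[OF True] t by (intro mult_left_mono) auto
          finally show ?thesis
            by (simp add: algebra_simps)
        qed (simp add: set_pmf_iff)
        obtain w where w: "\<And>a. pmf v a = t * pmf u a + (1 - t) * pmf w a"
          using pmf_extract[OF less_imp_le[OF t(1)] t(2) le] by blast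
        have "F v \<le> t * F u + (1 - t) * F w"
          using t by (intro pmf_convexD[OF F _ _ w]) auto
        also have "\<dots> \<le> t * F u + (1 - t) * B"
          using t B by (intro add_mono mult_left_mono) auto
        finally show ?thesis
          using t(3) by simp
      qed
      then show ?thesis
        using t m by (intro exI[of _ "(1 - t) * m"]) (auto simp: l1.in_mball)
    qed
    then show ?thesis
      unfolding l1_topology_def l1.openin_mtopology by auto
  qed
  then show ?thesis
    unfolding borel_measurable_iff_less by (auto intro: openin_in_sets_borel_of)
qed

subsection \<open>Joint laws\<close>

lemma is_policyD:
  assumes "is_policy \<pi>"
  shows "prob_space (\<pi> x)" "sets (\<pi> x) = sets (borel_of l1_topology)" "space (\<pi> x) = UNIV"
proof -
  have "\<pi> x \<in> prob_measures l1_topology"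
    using assms unfolding is_policy_def by blast
  note this[THEN in_prob_measuresD(1)] this[THEN in_prob_measuresD(2)] this[THEN in_prob_measuresD(3)]
  then show "prob_space (\<pi> x)" "sets (\<pi> x) = sets (borel_of l1_topology)" "space (\<pi> x) = UNIV"
    unfolding topspace_l1_topology .
qed

lemma measurable_policy_eq:
  "is_policy \<pi> \<Longrightarrow> measurable (\<pi> x) N = measurable (borel_of l1_topology) N"
  by (rule measurable_cong_sets[OF is_policyD(2) refl])

lemma prob_space_distr_Pair:
  assumes "is_policy \<pi>"
  shows "prob_space (distr (\<pi> x) (borel_of state_action_topology) (Pair x))"
  by (intro prob_space.prob_space_distr is_policyD assms)
    (simp add: measurable_policy_eq[OF assms] measurable_Pair_state_action)

lemma measurable_joint_kernel:
  fixes \<pi> :: "('x::finite, 'a::finite) policy"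
  assumes "is_policy \<pi>"
  shows "(\<lambda>x. distr (\<pi> x) (borel_of state_action_topology) (Pair x))
    \<in> measure_pmf \<mu> \<rightarrow>\<^sub>M subprob_algebra (borel_of state_action_topology)"
  using prob_space_distr_Pair[OF assms]
  by (auto intro!: measurable_count_space_eq1[THEN iffD2] prob_space_imp_subprob_space
      simp: measurable_cong_sets[OF sets_measure_pmf_count_space refl] space_subprob_algebra)

lemma sets_joint_law [simp]:
  fixes \<pi> :: "('x::finite, 'a::finite) policy"
  shows "sets (joint_law \<pi> \<mu>) = sets (borel_of state_action_topology)"
  unfolding joint_law_def by (subst sets_bind) auto

lemma prob_space_joint_law:
  fixes \<pi> :: "('x::finite, 'a::finite) policy"
  assumes "is_policy \<pi>"
  shows "prob_space (joint_law \<pi> \<mu>)"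
  unfolding joint_law_def
  by (rule measure_pmf.prob_space_bind[OF _ measurable_joint_kernel[OF assms]])
    (auto intro: prob_space_distr_Pair assms)

lemma emeasure_joint_law:
  fixes \<pi> :: "('x::finite, 'a::finite) policy"
  assumes \<pi>: "is_policy \<pi>" and B: "B \<in> sets (borel_of state_action_topology)"
  shows "emeasure (joint_law \<pi> \<mu>) B = (\<Sum>x\<in>UNIV. ennreal (pmf \<mu> x) * emeasure (\<pi> x) (Pair x -` B))"
proof -
  have "emeasure (joint_law \<pi> \<mu>) B
      = (\<integral>\<^sup>+x. emeasure (distr (\<pi> x) (borel_of state_action_topology) (Pair x)) B \<partial>\<mu>)"
    unfolding joint_law_def by (rule emeasure_bind[OF _ measurable_joint_kernel[OF \<pi>] B]) simp
  also have "\<dots> = (\<integral>\<^sup>+x. emeasure (\<pi> x) (Pair x -` B) \<partial>\<mu>)"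
    using B by (intro nn_integral_cong)
      (simp add: emeasure_distr measurable_policy_eq[OF \<pi>] measurable_Pair_state_action is_policyD[OF \<pi>])
  finally show ?thesis
    by (simp add: nn_integral_measure_pmf nn_integral_count_space_finite)
qed

lemma integral_joint_law:
  fixes \<pi> :: "('x::finite, 'a::finite) policy" and f :: "'x \<times> 'a pmf \<Rightarrow> real"
  assumes \<pi>: "is_policy \<pi>" and f: "f \<in> borel_measurable (borel_of state_action_topology)"
    and B: "\<And>z. \<bar>f z\<bar> \<le> B"
  shows "(\<integral>z. f z \<partial>joint_law \<pi> \<mu>) = (\<Sum>x\<in>UNIV. pmf \<mu> x * (\<integral>u. f (x, u) \<partial>\<pi> x))"
proof -
  have "(\<integral>z. f z \<partial>joint_law \<pi> \<mu>)
      = (\<integral>x. (\<integral>z. f z \<partial>distr (\<pi> x) (borel_of state_action_topology) (Pair x)) \<partial>\<mu>)"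
    unfolding joint_law_def
    by (rule integral_bind[OF f _ measurable_joint_kernel[OF \<pi>], where B = B and B' = 1])
      (use B prob_space_distr_Pair[OF \<pi>] in
        \<open>auto simp: measure_pmf.finite_measure_axioms prob_space.emeasure_space_1 AE_measure_pmf_iff
          simp del: space_distr\<close>)
  also have "\<dots> = (\<integral>x. (\<integral>u. f (x, u) \<partial>\<pi> x) \<partial>\<mu>)"
    by (intro Bochner_Integration.integral_cong refl integral_distr f)
      (simp add: measurable_policy_eq[OF \<pi>] measurable_Pair_state_action)
  also have "\<dots> = (\<Sum>x\<in>UNIV. pmf \<mu> x * (\<integral>u. f (x, u) \<partial>\<pi> x))"
    by (subst integral_measure_pmf[where A = UNIV]) auto
  finally show ?thesis .
qed

lemma borel_measurable_mean_kernel [measurable]: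
  fixes p :: "('x::finite, 'a::finite) kernel"
  shows "(\<lambda>z. pmf (mean_kernel p (fst z) (snd z) \<mu>) y) \<in> borel_measurable (borel_of state_action_topology)"
  by (rule borel_measurable_state_action) (simp add: pmf_mean_kernel)

subsection \<open>Trajectories\<close>

context Ionescu_Tulcea
begin

text \<open>\<open>CI\<close> at a finite index set projects the iterated kernel run up to the
  horizon \<open>up_to\<close>. For an initial segment that horizon is its length, so nothing is
  projected away. The empty history is \<open>\<lambda>_. undefined\<close>.\<close>

lemma distr_lim_restrict:
  "distr PF.lim (PiM {0..<n} M) (\<lambda>\<omega>. restrict \<omega> {0..<n}) = C 0 n (\<lambda>_. undefined)"
proof -
  have "up_to {0..<n} = n"
    by (intro antisym) (simp add: up_to_iff, metis atLeastLessThan_iff finite_atLeastLessThan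
        not_le_imp_less order_less_irrefl up_to_less zero_le)
  then show ?thesis
    using distr_C[of n n "\<lambda>_. undefined" 0] by (simp add: distr_lim CI_def)
qed

text \<open>A push-forward has the same total mass, so it suffices to look at the marginal on the
  empty set of coordinates.\<close>

lemma prob_space_lim: "prob_space PF.lim"
proof -
  have "prob_space (distr PF.lim (PiM {0..<0} M) (\<lambda>\<omega>. restrict \<omega> {0..<0}))"
    unfolding distr_lim_restrict by (rule prob_space_C) simp
  then show ?thesis
    by (rule prob_space_distrD[rotated])
      (auto simp: measurable_cong_sets[OF PF.sets_lim refl] intro!: measurable_restrict_subset)
qed

lemma measurable_lim_component [measurable]: "(\<lambda>\<omega>. \<omega> n) \<in> PF.lim \<rightarrow>\<^sub>M M n"
  by (simp add: measurable_cong_sets[OF PF.sets_lim refl])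

text \<open>Tower property at time \<open>n\<close>. The integrand sees only the first
  \<open>n + 1\<close> coordinates, whose law is that of the first \<open>n\<close> followed by
  \<open>eP n\<close>; boundedness of \<open>f\<close> allows the bind to be integrated in two
  stages, and \<open>eP n\<close> merely appends a draw from \<open>P n\<close>.\<close>

lemma integral_lim_component:
  fixes f :: "'a \<Rightarrow> real"
  assumes f [measurable]: "f \<in> borel_measurable (M n)" and B: "\<And>z. z \<in> space (M n) \<Longrightarrow> \<bar>f z\<bar> \<le> B"
  shows "(\<integral>\<omega>. f (\<omega> n) \<partial>PF.lim) = (\<integral>\<omega>. (\<integral>z. f z \<partial>P n (restrict \<omega> {0..<n})) \<partial>PF.lim)"
proof -
  let ?u = "\<lambda>_::nat. undefined :: 'a"
  have restr: "(\<lambda>\<omega>. restrict \<omega> {0..<k}) \<in> PF.lim \<rightarrow>\<^sub>M PiM {0..<k} M" for k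
    by (auto simp: measurable_cong_sets[OF PF.sets_lim refl] intro!: measurable_restrict_subset)
  have "(\<integral>\<omega>. f (\<omega> n) \<partial>PF.lim) = (\<integral>\<omega>. f (\<omega> n) \<partial>C 0 (Suc n) ?u)"
    unfolding distr_lim_restrict[symmetric] by (subst integral_distr[OF restr]) auto
  also have "\<dots> = (\<integral>\<omega>. (\<integral>\<omega>'. f (\<omega>' n) \<partial>eP n \<omega>) \<partial>C 0 n ?u)"
  proof -
    have u: "?u \<in> space (PiM {0..<0} M)"
      by simp
    interpret C: prob_space "C 0 n ?u"
      by (rule prob_space_C[OF u])
    have sets: "sets (C 0 n ?u) = sets (PiM {0..<n} M)"
      using sets_C[OF u, of n] by simp
    have sp: "space (C 0 n ?u) = space (PiM {0..<n} M)"
      using space_C[OF u, of n] by simp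
    have "(\<lambda>\<omega>. f (\<omega> n)) \<in> borel_measurable (PiM {0..<Suc n} M)"
      by measurable
    then have "(\<integral>\<omega>. f (\<omega> n) \<partial>(C 0 n ?u \<bind> eP n)) = (\<integral>\<omega>. (\<integral>\<omega>'. f (\<omega>' n) \<partial>eP n \<omega>) \<partial>C 0 n ?u)"
    proof (rule integral_bind[where B = B and B' = 1])
      show "\<bar>f (\<omega> n)\<bar> \<le> B" if "\<omega> \<in> space (PiM {0..<Suc n} M)" for \<omega>
        using that by (intro B) (auto simp: space_PiM PiE_iff)
      show "eP n \<in> C 0 n ?u \<rightarrow>\<^sub>M subprob_algebra (PiM {0..<Suc n} M)"
        unfolding measurable_cong_sets[OF sets refl] by (rule measurable_eP)
      show "AE \<omega> in C 0 n ?u. emeasure (eP n \<omega>) (space (eP n \<omega>)) \<le> ennreal 1"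
        by (rule AE_I2) (simp add: sp prob_space.emeasure_space_1[OF prob_space_eP])
    qed (rule C.finite_measure_axioms)
    then show ?thesis by simp
  qed
  also have "\<dots> = (\<integral>\<omega>. (\<integral>z. f z \<partial>P n \<omega>) \<partial>C 0 n ?u)"
  proof (rule Bochner_Integration.integral_cong[OF refl])
    fix \<omega> assume "\<omega> \<in> space (C 0 n ?u)"
    then have \<omega>: "\<omega> \<in> space (PiM {0..<n} M)"
      using space_C[of ?u 0 n] by simp
    have "fun_upd \<omega> n \<in> P n \<omega> \<rightarrow>\<^sub>M PiM {0..<Suc n} M"
      using \<omega> by (intro measurable_fun_upd[where J = "{0..<n}"])
        (auto simp: measurable_cong_sets[OF sets_P refl])
    then have "(\<integral>\<omega>'. f (\<omega>' n) \<partial>eP n \<omega>) = (\<integral>z. f ((fun_upd \<omega> n z) n) \<partial>P n \<omega>)"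
      unfolding eP_def by (subst integral_distr) auto
    then show "(\<integral>\<omega>'. f (\<omega>' n) \<partial>eP n \<omega>) = (\<integral>z. f z \<partial>P n \<omega>)"
      by simp
  qed
  also have "\<dots> = (\<integral>\<omega>. (\<integral>z. f z \<partial>P n (restrict \<omega> {0..<n})) \<partial>PF.lim)"
    unfolding distr_lim_restrict[symmetric]
    by (subst integral_distr[OF restr])
      (auto intro!: measurable_compose[OF P integral_measurable_subprob_algebra])
  finally show ?thesis .
qed

end

text \<open>Measurability in the history: by \<open>emeasure_joint_law\<close> the history enters
  only through the finitely many masses of \<open>mean_kernel\<close> at its last state-action pair,
  and at time 0 not at all.\<close>

lemma Ionescu_Tulcea_step_law:
  fixes p :: "('x::finite, 'a::finite) kernel"
  assumes \<pi>: "\<And>t. is_policy (\<pi> t)"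
  shows "Ionescu_Tulcea (step_law p \<mu> \<pi>) (\<lambda>_. borel_of state_action_topology)"
proof (rule Ionescu_Tulcea.intro)
  show "prob_space (step_law p \<mu> \<pi> i x)" for i x
    unfolding step_law_def by (rule prob_space_joint_law[OF \<pi>])
  fix i
  let ?N = "PiM {0..<i} (\<lambda>_. borel_of state_action_topology) :: (nat \<Rightarrow> 'x \<times> 'a pmf) measure"
  show "step_law p \<mu> \<pi> i \<in> ?N \<rightarrow>\<^sub>M subprob_algebra (borel_of state_action_topology)"
  proof (rule measurable_subprob_algebra)
    fix B :: "('x \<times> 'a pmf) set" assume B: "B \<in> sets (borel_of state_action_topology)"
    show "(\<lambda>\<omega>. emeasure (step_law p \<mu> \<pi> i \<omega>) B) \<in> borel_measurable ?N"
    proof (cases i)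
      case 0
      then show ?thesis by (simp add: step_law_def)
    next
      case (Suc j)
      have [measurable]: "(\<lambda>\<omega>. \<omega> j) \<in> ?N \<rightarrow>\<^sub>M borel_of state_action_topology"
        using Suc by (intro measurable_component_singleton) auto
      have "(\<lambda>\<omega>. pmf (mean_kernel p (fst (\<omega> j)) (snd (\<omega> j)) \<mu>) y) \<in> borel_measurable ?N" for y
        by (rule measurable_compose[OF _ borel_measurable_mean_kernel]) measurable
      then show ?thesis
        using Suc unfolding step_law_def by (simp add: emeasure_joint_law[OF \<pi> B])
    qed
  qed (auto simp: step_law_def intro!: prob_space_imp_subprob_space prob_space_joint_law \<pi>)
qed

lemma prob_space_trajectory_law:
  fixes p :: "('x::finite, 'a::finite) kernel"
  assumes "\<And>t. is_policy (\<pi> t)"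
  shows "prob_space (trajectory_law p \<mu> \<pi>)"
  unfolding trajectory_law_def
  by (rule Ionescu_Tulcea.prob_space_lim[OF Ionescu_Tulcea_step_law[OF assms]])

lemma measurable_trajectory_component:
  fixes p :: "('x::finite, 'a::finite) kernel"
  assumes "\<And>t. is_policy (\<pi> t)"
  shows "(\<lambda>\<omega>. \<omega> n) \<in> trajectory_law p \<mu> \<pi> \<rightarrow>\<^sub>M borel_of state_action_topology"
  unfolding trajectory_law_def
  by (rule Ionescu_Tulcea.measurable_lim_component[OF Ionescu_Tulcea_step_law[OF assms]])

lemma
  fixes p :: "('x::finite, 'a::finite) kernel" and f :: "'x \<times> 'a pmf \<Rightarrow> real"
  assumes \<pi>: "\<And>t. is_policy (\<pi> t)"
    and f: "f \<in> borel_measurable (borel_of state_action_topology)" and B: "\<And>z. \<bar>f z\<bar> \<le> B"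
  shows integral_trajectory_0:
      "(\<integral>\<omega>. f (\<omega> 0) \<partial>trajectory_law p \<mu> \<pi>) = (\<integral>z. f z \<partial>joint_law (\<pi> 0) \<mu>)"
    and integral_trajectory_Suc:
      "(\<integral>\<omega>. f (\<omega> (Suc n)) \<partial>trajectory_law p \<mu> \<pi>) =
        (\<integral>\<omega>. (\<integral>z. f z \<partial>joint_law (\<pi> (Suc n)) (mean_kernel p (fst (\<omega> n)) (snd (\<omega> n)) \<mu>))
          \<partial>trajectory_law p \<mu> \<pi>)"
proof -
  interpret prob_space "trajectory_law p \<mu> \<pi>"
    by (rule prob_space_trajectory_law[OF \<pi>])
  have eq: "(\<integral>\<omega>. f (\<omega> n) \<partial>trajectory_law p \<mu> \<pi>) =
      (\<integral>\<omega>. (\<integral>z. f z \<partial>step_law p \<mu> \<pi> n (restrict \<omega> {0..<n})) \<partial>trajectory_law p \<mu> \<pi>)" for n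
    unfolding trajectory_law_def
    by (rule Ionescu_Tulcea.integral_lim_component[OF Ionescu_Tulcea_step_law[OF \<pi>] f]) (rule B)
  show "(\<integral>\<omega>. f (\<omega> 0) \<partial>trajectory_law p \<mu> \<pi>) = (\<integral>z. f z \<partial>joint_law (\<pi> 0) \<mu>)"
    unfolding eq by (simp add: step_law_def prob_space)
  \<comment> \<open>Restricting the history to \<open>{0..<Suc n}\<close> changes nothing, as
    \<open>step_law\<close> at \<open>Suc n\<close> reads only its entry \<open>n\<close>.\<close>
  show "(\<integral>\<omega>. f (\<omega> (Suc n)) \<partial>trajectory_law p \<mu> \<pi>) =
      (\<integral>\<omega>. (\<integral>z. f z \<partial>joint_law (\<pi> (Suc n)) (mean_kernel p (fst (\<omega> n)) (snd (\<omega> n)) \<mu>))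
        \<partial>trajectory_law p \<mu> \<pi>)"
    unfolding eq by (simp add: step_law_def)
qed

text \<open>Performance difference identity. For an arbitrary \<open>V\<close>, the expectation of
  \<open>A\<close> at time \<open>n\<close> is the expected running cost plus
  \<open>\<beta> * v (Suc n) - v n\<close>, where \<open>v n\<close> is the expectation of
  \<open>V\<close> at the state of time \<open>n\<close>; after discounting, the last two terms
  telescope to \<open>- v 0\<close>. On the right only the expectations of \<open>A\<close> depend
  on the policy flow. Summability is recorded as well, because termwise nonnegativity bounds a
  \<open>suminf\<close> only for a convergent series.\<close>

lemma
  fixes p :: "('x::finite, 'a::finite) kernel" and g :: "'x \<times> 'a pmf \<Rightarrow> real" and V :: "'x \<Rightarrow> real"
  assumes \<pi>: "\<And>t. is_policy (\<pi> t)" and \<beta>: "0 \<le> \<beta>" "\<beta> < 1"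
    and g: "g \<in> borel_measurable (borel_of state_action_topology)" and B: "\<And>z. \<bar>g z\<bar> \<le> B"
    and A: "\<And>z. A z = g z + \<beta> * (\<Sum>y\<in>UNIV. V y * pmf (mean_kernel p (fst z) (snd z) \<mu>) y) - V (fst z)"
  shows performance_difference_summable:
      "summable (\<lambda>n. \<beta> ^ n * (\<integral>\<omega>. A (\<omega> n) \<partial>trajectory_law p \<mu> \<pi>))"
    and performance_difference:
      "(\<integral>\<omega>. (\<Sum>t. \<beta> ^ t * g (\<omega> t)) \<partial>trajectory_law p \<mu> \<pi>) =
        (\<Sum>x\<in>UNIV. V x * pmf \<mu> x) + (\<Sum>n. \<beta> ^ n * (\<integral>\<omega>. A (\<omega> n) \<partial>trajectory_law p \<mu> \<pi>))"
proof -
  let ?SA = "borel_of state_action_topology :: ('x \<times> 'a pmf) measure"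
  let ?P = "trajectory_law p \<mu> \<pi>"
  interpret T: prob_space ?P
    by (rule prob_space_trajectory_law[OF \<pi>])
  note comp = measurable_trajectory_component[OF \<pi>, of _ p \<mu>]
  have integrable: "integrable ?P (\<lambda>\<omega>. f (\<omega> n))"
    if "f \<in> borel_measurable ?SA" "\<And>z. \<bar>f z\<bar> \<le> D" for f :: "'x \<times> 'a pmf \<Rightarrow> real" and D n
    by (rule T.integrable_const_bound[of _ D])
      (use that(2) measurable_compose[OF comp that(1)] in auto)
  define VB where "VB = (\<Sum>x\<in>UNIV. \<bar>V x\<bar>)"
  have VB: "\<bar>V x\<bar> \<le> VB" for x
    unfolding VB_def by (rule member_le_sum) auto
  have V: "(\<lambda>z. V (fst z)) \<in> borel_measurable ?SA"
    by (rule borel_measurable_state_action) simp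
  define W where "W z = (\<Sum>y\<in>UNIV. V y * pmf (mean_kernel p (fst z) (snd z) \<mu>) y)" for z
  have W: "W \<in> borel_measurable ?SA"
    unfolding W_def by measurable
  \<comment> \<open>Policies are probability kernels, so they drop out when a function of the state
    alone is integrated; hence \<open>vSuc\<close> involves only the transition kernel.\<close>
  have int_V: "(\<integral>z. V (fst z) \<partial>joint_law (\<pi> n) \<nu>) = (\<Sum>x\<in>UNIV. V x * pmf \<nu> x)" for n \<nu>
    by (subst integral_joint_law[OF \<pi> V VB])
      (simp add: prob_space.prob_space[OF is_policyD(1)[OF \<pi>]] mult.commute)
  have WB: "\<bar>W z\<bar> \<le> VB" for z
  proof -
    have "\<bar>W z\<bar> \<le> (\<Sum>y\<in>UNIV. \<bar>V y * pmf (mean_kernel p (fst z) (snd z) \<mu>) y\<bar>)"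
      unfolding W_def by (rule sum_abs)
    also have "\<dots> \<le> VB"
      unfolding VB_def by (intro sum_mono) (simp add: abs_mult mult_left_le pmf_le_1)
    finally show ?thesis .
  qed
  define v where "v n = (\<integral>\<omega>. V (fst (\<omega> n)) \<partial>?P)" for n
  have v0: "v 0 = (\<Sum>x\<in>UNIV. V x * pmf \<mu> x)"
    unfolding v_def using integral_trajectory_0[OF \<pi> V VB, of p \<mu>] int_V by simp
  have vSuc: "v (Suc n) = (\<integral>\<omega>. W (\<omega> n) \<partial>?P)" for n
    unfolding v_def integral_trajectory_Suc[OF \<pi> V VB] int_V W_def ..
  have vB: "\<bar>v n\<bar> \<le> VB" for n
  proof -
    have "\<bar>v n\<bar> \<le> (\<integral>\<omega>. \<bar>V (fst (\<omega> n))\<bar> \<partial>?P)"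
      unfolding v_def by (rule integral_abs_bound)
    also have "\<dots> \<le> VB"
      by (rule T.integral_le_const) (auto simp: VB intro!: integrable_abs integrable[OF V VB])
    finally show ?thesis .
  qed
  have EA: "(\<integral>\<omega>. A (\<omega> n) \<partial>?P) = (\<integral>\<omega>. g (\<omega> n) \<partial>?P) + \<beta> * v (Suc n) - v n" for n
    unfolding A W_def[symmetric] vSuc unfolding v_def
    by (simp add: integrable[OF g B] integrable[OF V VB] integrable[OF W WB])
  have gB: "\<bar>\<beta> ^ t * g z\<bar> \<le> B * \<beta> ^ t" for t z
    using B[of z] \<beta> by (simp add: abs_mult mult.commute mult_right_mono)
  have geom: "summable (\<lambda>t. B * \<beta> ^ t)"
    using \<beta> by (intro summable_mult summable_geometric) simp
  have int_g: "integrable ?P (\<lambda>\<omega>. \<beta> ^ t * g (\<omega> t))" for t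
    using integrable[OF g B] by simp
  have gE: "(\<integral>\<omega>. \<bar>\<beta> ^ t * g (\<omega> t)\<bar> \<partial>?P) \<le> B * \<beta> ^ t" for t
    by (rule T.integral_le_const) (use gB int_g in auto)
  have Eg: "(\<integral>\<omega>. (\<Sum>t. \<beta> ^ t * g (\<omega> t)) \<partial>?P) = (\<Sum>t. \<integral>\<omega>. \<beta> ^ t * g (\<omega> t) \<partial>?P)"
  proof (rule integral_suminf[OF int_g])
    show "AE \<omega> in ?P. summable (\<lambda>t. norm (\<beta> ^ t * g (\<omega> t)))"
      by (intro AE_I2 summable_comparison_test[OF _ geom]) (use gB in auto)
    show "summable (\<lambda>t. \<integral>\<omega>. norm (\<beta> ^ t * g (\<omega> t)) \<partial>?P)"
      by (intro summable_comparison_test[OF _ geom]) (use gE in auto)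
  qed
  have sum_g: "summable (\<lambda>t. \<integral>\<omega>. \<beta> ^ t * g (\<omega> t) \<partial>?P)"
  proof (rule summable_comparison_test[OF _ geom], intro exI allI impI)
    fix t
    show "norm (\<integral>\<omega>. \<beta> ^ t * g (\<omega> t) \<partial>?P) \<le> B * \<beta> ^ t"
      using integral_abs_bound[of ?P "\<lambda>\<omega>. \<beta> ^ t * g (\<omega> t)"] gE[of t] by simp
  qed
  \<comment> \<open>Discounting removes the boundary term of the telescoping sum, since
    \<open>v\<close> is bounded.\<close>
  have "(\<lambda>n. \<beta> ^ n * v n) \<longlonglongrightarrow> 0"
  proof (rule Lim_null_comparison)
    show "\<forall>\<^sub>F n in sequentially. norm (\<beta> ^ n * v n) \<le> \<beta> ^ n * VB"
      using vB \<beta> by (auto simp: abs_mult mult_left_mono)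
    show "(\<lambda>n. \<beta> ^ n * VB) \<longlonglongrightarrow> 0"
      using \<beta> by (intro tendsto_mult_left_zero LIMSEQ_power_zero) simp
  qed
  then have "(\<lambda>n. \<beta> ^ n * v n - \<beta> ^ Suc n * v (Suc n)) sums (\<beta> ^ 0 * v 0 - 0)"
    by (rule telescope_sums')
  from sums_diff[OF summable_sums[OF sum_g] this]
  have sums: "(\<lambda>n. \<beta> ^ n * (\<integral>\<omega>. A (\<omega> n) \<partial>?P)) sums ((\<Sum>t. \<integral>\<omega>. \<beta> ^ t * g (\<omega> t) \<partial>?P) - v 0)"
    by (simp add: EA algebra_simps)
  then show "summable (\<lambda>n. \<beta> ^ n * (\<integral>\<omega>. A (\<omega> n) \<partial>?P))"
    by (rule sums_summable)
  show "(\<integral>\<omega>. (\<Sum>t. \<beta> ^ t * g (\<omega> t)) \<partial>?P) =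
      (\<Sum>x\<in>UNIV. V x * pmf \<mu> x) + (\<Sum>n. \<beta> ^ n * (\<integral>\<omega>. A (\<omega> n) \<partial>?P))"
    using sums_unique[OF sums] by (simp add: Eg v0)
qed

lemma linear_diff_le:
  fixes w w' :: "'a::finite \<Rightarrow> real"
  shows "\<bar>(\<Sum>a\<in>UNIV. w a * pmf u a) - (\<Sum>a\<in>UNIV. w' a * pmf u a)\<bar> \<le> (\<Sum>a\<in>UNIV. \<bar>w a - w' a\<bar>)"
proof -
  have "\<bar>(\<Sum>a\<in>UNIV. w a * pmf u a) - (\<Sum>a\<in>UNIV. w' a * pmf u a)\<bar> = \<bar>\<Sum>a\<in>UNIV. (w a - w' a) * pmf u a\<bar>"
    by (simp add: sum_subtractf algebra_simps)
  also have "\<dots> \<le> (\<Sum>a\<in>UNIV. \<bar>(w a - w' a) * pmf u a\<bar>)"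
    by (rule sum_abs)
  also have "\<dots> \<le> (\<Sum>a\<in>UNIV. \<bar>w a - w' a\<bar>)"
    by (intro sum_mono) (simp add: abs_mult mult_left_le pmf_le_1)
  finally show ?thesis .
qed

subsection \<open>Regularized models\<close>

text \<open>Attainment of the minimum is an assumption: a strongly convex function on the simplex
  may jump up at the boundary and miss its infimum. It is asked for exactly on the family affine
  plus \<open>\<rho> * \<Omega>\<close>, which is stable under \<open>H1\<close>.\<close>

locale regularized_model =
  fixes c :: "('x::finite, 'a::finite) cost" and p :: "('x, 'a) kernel"
    and \<Omega> :: "'a pmf \<Rightarrow> real" and \<rho> \<beta> L K :: real
  assumes \<beta>_pos: "0 < \<beta>" and \<beta>_less_1: "\<beta> < 1" and \<rho>_pos: "0 < \<rho>"
    and strongly_convex: "l1_strongly_convex \<Omega>"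
    and ex1_arg_min: "\<And>w :: 'a \<Rightarrow> real.
      \<exists>!u. is_arg_min (\<lambda>u. (\<Sum>a\<in>UNIV. w a * pmf u a) + \<rho> * \<Omega> u) (\<lambda>_. True) u"
    and lipschitz: "lipschitz_model c p L K"
begin

definition reg :: "('a \<Rightarrow> real) \<Rightarrow> 'a pmf \<Rightarrow> real"
  where "reg w u = (\<Sum>a\<in>UNIV. w a * pmf u a) + \<rho> * \<Omega> u"

definition minimizer :: "('a \<Rightarrow> real) \<Rightarrow> 'a pmf"
  where "minimizer w = (THE u. is_arg_min (reg w) (\<lambda>_. True) u)"

definition val :: "('a \<Rightarrow> real) \<Rightarrow> real"
  where "val w = reg w (minimizer w)"

text \<open>The operator \<open>H1\<close> read on affine coefficients; \<open>H1_reg\<close> makes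
  this precise.\<close>

definition backup :: "('x \<Rightarrow> 'a \<Rightarrow> real) \<Rightarrow> 'x pmf \<Rightarrow> 'x \<Rightarrow> 'a \<Rightarrow> real"
  where "backup q \<mu> x a = c x a \<mu> + \<beta> * (\<Sum>y\<in>UNIV. val (q y) * pmf (p x a \<mu>) y)"

definition det_policy :: "('x \<Rightarrow> 'a \<Rightarrow> real) \<Rightarrow> ('x, 'a) policy"
  where "det_policy q x = return (borel_of l1_topology) (minimizer (q x))"

lemma is_arg_min_iff: "is_arg_min (reg w) (\<lambda>_. True) u \<longleftrightarrow> u = minimizer w"
proof -
  have ex1: "\<exists>!u. is_arg_min (reg w) (\<lambda>_. True) u"
    using ex1_arg_min[of w] by (simp add: reg_def[abs_def])
  then show ?thesis
    using theI'[OF ex1] unfolding minimizer_def by auto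
qed

lemma val_le: "val w \<le> reg w u"
proof -
  have "is_arg_min (reg w) (\<lambda>_. True) (minimizer w)"
    by (simp add: is_arg_min_iff)
  then show ?thesis
    unfolding is_arg_min_def val_def by (meson not_le)
qed

lemma INF_reg: "(INF u. reg w u) = val w"
  by (rule cInf_eq_minimum) (auto simp: val_def val_le[unfolded val_def])

lemma val_lipschitz: "\<bar>val w - val w'\<bar> \<le> (\<Sum>a\<in>UNIV. \<bar>w a - w' a\<bar>)"
proof -
  have "\<bar>reg w u - reg w' u\<bar> \<le> (\<Sum>a\<in>UNIV. \<bar>w a - w' a\<bar>)" for u
    using linear_diff_le[of w u w'] by (simp add: reg_def)
  from this[of "minimizer w"] this[of "minimizer w'"] show ?thesis
    using val_le[of w "minimizer w'"] val_le[of w' "minimizer w"]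
    unfolding val_def by linarith
qed

text \<open>The minimum is compared with the value at the midpoint \<open>v\<close> of the minimizer
  and \<open>u\<close>. Strong convexity gains \<open>\<rho> / 8\<close> times the squared distance
  there, and solving for \<open>val w\<close>, which also appears with weight 1/2 on the right,
  doubles the constant to \<open>\<rho> / 4\<close>.\<close>

lemma quadratic_growth: "val w + \<rho> / 4 * (l1_dist (minimizer w) u)\<^sup>2 \<le> reg w u"
proof -
  let ?m = "minimizer w"
  obtain v where v: "\<And>a. pmf v a = 1/2 * pmf ?m a + (1 - 1/2) * pmf u a"
    using pmf_mix_ex[of "1/2" ?m u] by auto
  have "\<Omega> v \<le> 1/2 * \<Omega> ?m + (1 - 1/2) * \<Omega> u - 1/2 * (1/2) * (1 - 1/2) * (l1_dist ?m u)\<^sup>2"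
    using strongly_convex v unfolding l1_strongly_convex_def by (metis atLeastAtMost_iff
        half_gt_zero_iff less_eq_real_def zero_less_one field_sum_of_halves le_add_same_cancel1)
  then have "\<rho> * \<Omega> v \<le> \<rho> * (1/2 * \<Omega> ?m + 1/2 * \<Omega> u - 1/8 * (l1_dist ?m u)\<^sup>2)"
    using \<rho>_pos by (intro mult_left_mono) auto
  moreover have "(\<Sum>a\<in>UNIV. w a * pmf v a) = 1/2 * (\<Sum>a\<in>UNIV. w a * pmf ?m a) + 1/2 * (\<Sum>a\<in>UNIV. w a * pmf u a)"
    by (simp add: v algebra_simps sum.distrib sum_distrib_left)
  ultimately have "reg w v \<le> 1/2 * reg w ?m + 1/2 * reg w u - \<rho> / 8 * (l1_dist ?m u)\<^sup>2"
    unfolding reg_def by (simp add: algebra_simps)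
  with val_le[of w v] show ?thesis
    unfolding val_def by simp
qed

text \<open>Quadratic growth of \<open>reg w\<close> tested at \<open>minimizer w'\<close> is added
  to that of \<open>reg w'\<close> tested at \<open>minimizer w\<close>. \<Omega> cancels, and what
  is left is bilinear in \<open>w - w'\<close> and the difference of the minimizers. The two
  constants \<open>\<rho> / 4\<close> add up to \<open>\<rho> / 2\<close>, whose inverse is the
  Lipschitz constant.\<close>

lemma minimizer_lipschitz:
  "l1_dist (minimizer w) (minimizer w') \<le> 2 / \<rho> * (\<Sum>a\<in>UNIV. \<bar>w a - w' a\<bar>)"
proof -
  let ?m = "minimizer w" and ?n = "minimizer w'"
  let ?d = "l1_dist ?m ?n" and ?D = "\<Sum>a\<in>UNIV. \<bar>w a - w' a\<bar>"
  have D: "0 \<le> ?D"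
    by (simp add: sum_nonneg)
  have "\<rho> / 2 * ?d\<^sup>2 \<le> (reg w ?n - reg w' ?n) - (reg w ?m - reg w' ?m)"
    using quadratic_growth[of w ?n] quadratic_growth[of w' ?m]
    by (simp add: val_def l1.commute[of ?n])
  also have "\<dots> = (\<Sum>a\<in>UNIV. (w a - w' a) * (pmf ?n a - pmf ?m a))"
    by (simp add: reg_def algebra_simps sum_subtractf sum.distrib)
  also have "\<dots> \<le> (\<Sum>a\<in>UNIV. \<bar>w a - w' a\<bar> * ?d)"
  proof (rule sum_mono)
    fix a
    have "(w a - w' a) * (pmf ?n a - pmf ?m a) \<le> \<bar>w a - w' a\<bar> * \<bar>pmf ?n a - pmf ?m a\<bar>"
      by (simp add: abs_mult[symmetric])
    also have "\<dots> \<le> \<bar>w a - w' a\<bar> * ?d"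
      using abs_pmf_diff_le_l1_dist[of ?n a ?m] by (intro mult_left_mono) (auto simp: l1.commute)
    finally show "(w a - w' a) * (pmf ?n a - pmf ?m a) \<le> \<bar>w a - w' a\<bar> * ?d" .
  qed
  also have "\<dots> = ?D * ?d"
    by (simp add: sum_distrib_right)
  finally have "(\<rho> / 2 * ?d) * ?d \<le> ?D * ?d"
    by (simp add: power2_eq_square mult.assoc)
  \<comment> \<open>One factor \<open>?d\<close> is cancelled; if it is 0 the claim reduces to
    \<open>0 \<le> ?D\<close>.\<close>
  then have "\<rho> / 2 * ?d \<le> ?D"
    using D by (cases "?d = 0") (auto simp: less_le)
  then show ?thesis
    using \<rho>_pos by (simp add: field_simps)
qed

lemma pmf_convex_\<Omega>: "pmf_convex \<Omega>"
  unfolding pmf_convex_def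
proof (intro allI ballI impI)
  fix u v w :: "'a pmf" and t :: real
  assume t: "t \<in> {0..1}" and w: "\<forall>a. pmf w a = t * pmf u a + (1 - t) * pmf v a"
  have "\<Omega> w \<le> t * \<Omega> u + (1 - t) * \<Omega> v - 1/2 * t * (1 - t) * (l1_dist u v)\<^sup>2"
    using strongly_convex t w unfolding l1_strongly_convex_def by blast
  moreover have "0 \<le> 1/2 * t * (1 - t) * (l1_dist u v)\<^sup>2"
    using t by simp
  ultimately show "\<Omega> w \<le> t * \<Omega> u + (1 - t) * \<Omega> v"
    by linarith
qed

text \<open>Above, convexity bounds \<Omega> by its largest value at a vertex; below,
  \<open>\<rho> * \<Omega>\<close> itself, the case \<open>w = 0\<close>, attains its
  minimum.\<close>

lemma \<Omega>_bounded: "\<exists>B. \<forall>u. \<bar>\<Omega> u\<bar> \<le> B"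
proof -
  have upper: "\<Omega> u \<le> Max (range (\<lambda>a. \<Omega> (return_pmf a)))" for u
    by (rule pmf_convex_le_vertices[OF pmf_convex_\<Omega>]) simp
  have lower: "\<Omega> (minimizer (\<lambda>_. 0)) \<le> \<Omega> u" for u
    using val_le[of "\<lambda>_. 0" u] \<rho>_pos by (simp add: val_def reg_def)
  show ?thesis
    by (rule exI[of _ "\<bar>Max (range (\<lambda>a. \<Omega> (return_pmf a)))\<bar> + \<bar>\<Omega> (minimizer (\<lambda>_. 0))\<bar>"])
      (use upper lower in \<open>smt (verit)\<close>)
qed

lemma is_policy_det_policy: "is_policy (det_policy q)"
  by (auto simp: is_policy_def det_policy_def space_prob_algebra intro!: prob_space_return)

lemma integral_det_policy:
  fixes f :: "'a pmf \<Rightarrow> real"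
  assumes "f \<in> borel_measurable (borel_of l1_topology)"
  shows "(\<integral>u. f u \<partial>det_policy q x) = f (minimizer (q x))"
  unfolding det_policy_def by (rule integral_return) (use assms in auto)

lemma greedy_det_policy: "greedy (det_policy q) (\<lambda>x. reg (q x))"
  unfolding greedy_def is_arg_min_iff
proof
  fix x
  have "Measurable.pred (borel_of l1_topology) (\<lambda>u. u = minimizer (q x))"
    using singleton_in_sets_l1[of "minimizer (q x)"] by (simp add: pred_def)
  then show "AE u in det_policy q x. u = minimizer (q x)"
    unfolding det_policy_def by (subst AE_return) auto
qed

text \<open>Minimizers are unique, so each \<open>\<pi> x\<close> is carried by one point and gives
  every measurable set mass 0 or 1. This is what lets tables replace policies.\<close>

lemma greedy_imp_det_policy:
  assumes \<pi>: "is_policy \<pi>" and greedy: "greedy \<pi> (\<lambda>x. reg (q x))"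
  shows "\<pi> = det_policy q"
proof
  fix x
  interpret prob_space "\<pi> x"
    by (rule is_policyD(1)[OF \<pi>])
  have AE: "AE u in \<pi> x. u = minimizer (q x)"
    using greedy unfolding greedy_def is_arg_min_iff by auto
  show "\<pi> x = det_policy q x"
  proof (rule measure_eqI)
    show "sets (\<pi> x) = sets (det_policy q x)"
      by (simp add: is_policyD(2)[OF \<pi>] det_policy_def)
    fix B assume B: "B \<in> sets (\<pi> x)"
    have "emeasure (\<pi> x) B = emeasure (\<pi> x) (if minimizer (q x) \<in> B then space (\<pi> x) else {})"
      using AE B by (intro emeasure_eq_AE) (auto elim: eventually_mono)
    also have "\<dots> = indicator B (minimizer (q x))"
      by (simp add: emeasure_space_1)
    finally show "emeasure (\<pi> x) B = emeasure (det_policy q x) B"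
      using B by (simp add: det_policy_def is_policyD(2)[OF \<pi>])
  qed
qed

text \<open>\<open>mean_cost\<close> and \<open>mean_kernel\<close> are affine in \<open>u\<close>,
  so the mixture over actions can be pulled out of the sum over next states.\<close>

lemma H1_reg: "H1 c p \<Omega> \<rho> \<beta> (\<lambda>x. reg (q x)) \<mu> = (\<lambda>x. reg (backup q \<mu> x))"
proof (intro ext)
  fix x u
  have "(\<Sum>y\<in>UNIV. val (q y) * pmf (mean_kernel p x u \<mu>) y)
      = (\<Sum>a\<in>UNIV. (\<Sum>y\<in>UNIV. val (q y) * pmf (p x a \<mu>) y) * pmf u a)"
    unfolding pmf_mean_kernel sum_distrib_left sum_distrib_right
    by (subst sum.swap) (simp add: mult.assoc)
  then have "reg (backup q \<mu> x) u = mean_cost c x u \<mu> + \<rho> * \<Omega> u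
      + \<beta> * (\<Sum>y\<in>UNIV. val (q y) * pmf (mean_kernel p x u \<mu>) y)"
    by (simp add: reg_def backup_def mean_cost_def distrib_right sum.distrib mult.assoc
        sum_distrib_left[symmetric])
  then show "H1 c p \<Omega> \<rho> \<beta> (\<lambda>x. reg (q x)) \<mu> x u = reg (backup q \<mu> x) u"
    by (simp add: H1_def INF_reg)
qed

text \<open>At the vertex \<open>return_pmf a\<close> the affine part is the entry at
  \<open>a\<close>, and \<Omega> cancels.\<close>

lemma reg_inject: "(\<lambda>x. reg (q x)) = (\<lambda>x. reg (q' x)) \<longleftrightarrow> q = q'"
proof
  have vertex: "(\<Sum>b\<in>UNIV. w b * pmf (return_pmf a) b) = w a" for w :: "'a \<Rightarrow> real" and a
    by (simp add: indicator_def if_distrib[of "\<lambda>t. _ * t"] sum.delta cong: if_cong)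
  assume "(\<lambda>x. reg (q x)) = (\<lambda>x. reg (q' x))"
  then have "reg (q x) (return_pmf a) = reg (q' x) (return_pmf a)" for x a
    by metis
  then show "q = q'"
    by (intro ext) (simp add: reg_def vertex)
qed simp

text \<open>\<open>embed_pmf\<close> is under control only on probability vectors; here its argument
  is the mass function of a two-stage draw, first the state and then the transition.\<close>

lemma pmf_H2_det_policy:
  "pmf (H2 p (det_policy q) \<mu>) y = (\<Sum>x\<in>UNIV. pmf (mean_kernel p x (minimizer (q x)) \<mu>) y * pmf \<mu> x)"
proof -
  have "H2 p (det_policy q) \<mu>
      = embed_pmf (\<lambda>y. \<Sum>x\<in>UNIV. pmf (mean_kernel p x (minimizer (q x)) \<mu>) y * pmf \<mu> x)"
    unfolding H2_def
    by (subst integral_det_policy) (simp_all add: pmf_mean_kernel)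
  also have "(\<lambda>y. \<Sum>x\<in>UNIV. pmf (mean_kernel p x (minimizer (q x)) \<mu>) y * pmf \<mu> x)
      = pmf (bind_pmf \<mu> (\<lambda>x. mean_kernel p x (minimizer (q x)) \<mu>))"
    unfolding pmf_bind by (subst integral_measure_pmf[where A = UNIV]) (auto simp: mult.commute)
  also have "embed_pmf \<dots> = bind_pmf \<mu> (\<lambda>x. mean_kernel p x (minimizer (q x)) \<mu>)"
    by (rule type_definition.Rep_inverse[OF td_pmf_embed_pmf])
  finally show ?thesis
    by (simp add: pmf_bind) (subst integral_measure_pmf[where A = UNIV], auto simp: mult.commute)
qed

theorem stationary_MFE_det_policy:
  assumes q: "q = backup q \<mu>" and \<mu>: "\<mu> = H2 p (det_policy q) \<mu>"
  shows "stationary_MFE c p \<Omega> \<rho> \<beta> (det_policy q) \<mu>"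
proof -
  let ?SA = "borel_of state_action_topology :: ('x \<times> 'a pmf) measure"
  define g where "g z = mean_cost c (fst z) (snd z) \<mu> + \<rho> * \<Omega> (snd z)" for z
  define A where "A z = reg (q (fst z)) (snd z) - val (q (fst z))" for z
  have A_nonneg: "0 \<le> A z" for z
    by (simp add: A_def val_le)
  \<comment> \<open>The fixed point equation identifies the gap above the minimum with the one-step
    discrepancy of \<open>performance_difference\<close> for
    \<open>V = (\<lambda>x. val (q x))\<close>.\<close>
  have A: "A z = g z + \<beta> * (\<Sum>y\<in>UNIV. val (q y) * pmf (mean_kernel p (fst z) (snd z) \<mu>) y) - val (q (fst z))"
    for z
  proof -
    have "reg (q (fst z)) (snd z) = reg (backup q \<mu> (fst z)) (snd z)"
      using q by simp
    also have "\<dots> = H1 c p \<Omega> \<rho> \<beta> (\<lambda>x. reg (q x)) \<mu> (fst z) (snd z)"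
      by (simp add: H1_reg)
    finally show ?thesis
      by (simp add: A_def H1_def INF_reg g_def)
  qed
  have \<Omega>: "\<Omega> \<in> borel_measurable (borel_of l1_topology)"
    by (rule pmf_convex_borel_measurable[OF pmf_convex_\<Omega>])
  have g: "g \<in> borel_measurable ?SA"
    unfolding g_def mean_cost_def
    by (rule borel_measurable_state_action) (use \<Omega> in simp)
  have A_meas: "A \<in> borel_measurable ?SA"
    unfolding A_def reg_def
    by (rule borel_measurable_state_action) (use \<Omega> in simp)
  obtain D where D: "\<And>u. \<bar>\<Omega> u\<bar> \<le> D"
    using \<Omega>_bounded by auto
  have lin_bound: "\<bar>\<Sum>a\<in>UNIV. w x a * pmf u a\<bar> \<le> (\<Sum>y\<in>UNIV. \<Sum>a\<in>UNIV. \<bar>w y a\<bar>)"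
    for w :: "'x \<Rightarrow> 'a \<Rightarrow> real" and x u
  proof -
    have "\<bar>\<Sum>a\<in>UNIV. w x a * pmf u a\<bar> \<le> (\<Sum>a\<in>UNIV. \<bar>w x a\<bar>)"
      using linear_diff_le[of "w x" u "\<lambda>_. 0"] by simp
    also have "\<dots> \<le> (\<Sum>y\<in>UNIV. \<Sum>a\<in>UNIV. \<bar>w y a\<bar>)"
      by (rule member_le_sum[where f = "\<lambda>y. \<Sum>a\<in>UNIV. \<bar>w y a\<bar>"]) (auto intro: sum_nonneg)
    finally show ?thesis .
  qed
  have \<rho>\<Omega>: "\<bar>\<rho> * \<Omega> u\<bar> \<le> \<rho> * D" for u
    using \<rho>_pos D by (simp add: abs_mult)
  have gB: "\<bar>g z\<bar> \<le> (\<Sum>y\<in>UNIV. \<Sum>a\<in>UNIV. \<bar>c y a \<mu>\<bar>) + \<rho> * D" for z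
    unfolding g_def mean_cost_def
    using lin_bound[of "\<lambda>x a. c x a \<mu>" "fst z" "snd z"] \<rho>\<Omega>[of "snd z"] by linarith
  define E where "E = (\<Sum>y\<in>UNIV. \<Sum>a\<in>UNIV. \<bar>q y a\<bar>) + \<rho> * D + (\<Sum>y\<in>UNIV. \<bar>val (q y)\<bar>)"
  have AB: "\<bar>A z\<bar> \<le> E" for z
  proof -
    have "\<bar>val (q (fst z))\<bar> \<le> (\<Sum>y\<in>UNIV. \<bar>val (q y)\<bar>)"
      by (rule member_le_sum) auto
    then show ?thesis
      unfolding A_def reg_def E_def
      using lin_bound[of q "fst z" "snd z"] \<rho>\<Omega>[of "snd z"] by linarith
  qed
  have cost: "discounted_cost c p \<Omega> \<rho> \<beta> \<mu> \<pi> = (\<Sum>x\<in>UNIV. val (q x) * pmf \<mu> x)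
      + (\<Sum>n. \<beta> ^ n * (\<integral>\<omega>. A (\<omega> n) \<partial>trajectory_law p \<mu> \<pi>))"
    and summable: "summable (\<lambda>n. \<beta> ^ n * (\<integral>\<omega>. A (\<omega> n) \<partial>trajectory_law p \<mu> \<pi>))"
    if \<pi>: "\<And>t. is_policy (\<pi> t)" for \<pi>
    using performance_difference[where g = g and V = "\<lambda>x. val (q x)" and A = A, OF \<pi> _ _ g gB A]
      performance_difference_summable[where g = g and V = "\<lambda>x. val (q x)" and A = A, OF \<pi> _ _ g gB A]
      \<beta>_pos \<beta>_less_1 by (simp_all add: discounted_cost_def g_def)
  have det: "is_policy (det_policy q)"
    by (rule is_policy_det_policy)
  \<comment> \<open>The gap has mean zero under \<open>det_policy q\<close> for every law
    \<open>\<nu>\<close> of the state, hence at time 0 and, conditionally on the past, at every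
    later time.\<close>
  have "(\<integral>z. A z \<partial>joint_law (det_policy q) \<nu>) = 0" for \<nu>
  proof -
    have "(\<integral>u. A (x, u) \<partial>det_policy q x) = 0" for x
    proof -
      have "(\<lambda>u. A (x, u)) \<in> borel_measurable (borel_of l1_topology)"
        by (rule measurable_compose[OF measurable_Pair_state_action A_meas])
      then show ?thesis
        by (simp add: integral_det_policy A_def val_def)
    qed
    then show ?thesis
      by (simp add: integral_joint_law[OF det A_meas AB])
  qed
  then have "(\<integral>\<omega>. A (\<omega> n) \<partial>trajectory_law p \<mu> (\<lambda>_. det_policy q)) = 0" for n
    by (cases n) (simp_all add: integral_trajectory_0[OF det A_meas AB] integral_trajectory_Suc[OF det A_meas AB])
  then have opt: "discounted_cost c p \<Omega> \<rho> \<beta> \<mu> (\<lambda>_. det_policy q) = (\<Sum>x\<in>UNIV. val (q x) * pmf \<mu> x)"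
    using cost[of "\<lambda>_. det_policy q"] det by simp
  have "discounted_cost c p \<Omega> \<rho> \<beta> \<mu> (\<lambda>_. det_policy q) \<le> discounted_cost c p \<Omega> \<rho> \<beta> \<mu> \<pi>"
    if \<pi>: "\<forall>t. is_policy (\<pi> t)" for \<pi>
  proof -
    have "0 \<le> (\<Sum>n. \<beta> ^ n * (\<integral>\<omega>. A (\<omega> n) \<partial>trajectory_law p \<mu> \<pi>))"
      by (intro suminf_nonneg summable mult_nonneg_nonneg integral_nonneg)
        (use \<pi> A_nonneg \<beta>_pos in auto)
    then show ?thesis
      using cost[of \<pi>] \<pi> by (simp add: opt)
  qed
  then show ?thesis
    using det \<mu> by (simp add: stationary_MFE_def)
qed

end

subsection \<open>Limits of finite-horizon flows\<close>

lemma pmf_limit_ex: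
  fixes M :: "nat \<Rightarrow> 'x::finite pmf"
  assumes lim: "\<And>x. (\<lambda>n. pmf (M n) x) \<longlonglongrightarrow> l x"
  obtains m where "\<And>x. pmf m x = l x"
proof
  have nn: "0 \<le> l x" for x
    by (rule LIMSEQ_le_const[OF lim]) simp
  have "(\<lambda>n. \<Sum>x\<in>UNIV. pmf (M n) x) \<longlonglongrightarrow> (\<Sum>x\<in>UNIV. l x)"
    by (intro tendsto_sum lim)
  then have "(\<Sum>x\<in>UNIV. l x) = 1"
    by (simp add: sum_pmf_eq_1 LIMSEQ_const_iff)
  then have "(\<integral>\<^sup>+x. ennreal (l x) \<partial>count_space UNIV) = 1"
    by (simp add: nn_integral_count_space_finite sum_ennreal nn)
  then show "pmf (embed_pmf l) x = l x" for x
    by (intro pmf_embed_pmf nn)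
qed

text \<open>All times are treated at once: the masses form a point of the cube over
  \<open>nat \<times> 'x\<close>, which is compact and, having countably many coordinates,
  sequentially compact. Finiteness of \<open>'x\<close> keeps mass from escaping in the
  limit.\<close>

lemma pmf_seq_compact:
  fixes M :: "nat \<Rightarrow> nat \<Rightarrow> 'x::finite pmf"
  obtains r m where "strict_mono (r :: nat \<Rightarrow> nat)"
    "\<And>t x. (\<lambda>n. pmf (M (r n) t) x) \<longlonglongrightarrow> pmf (m t) x"
proof -
  define F where "F n = (\<lambda>(t, x). pmf (M n t) x)" for n
  have "compactin (product_topology (\<lambda>_. euclideanreal) UNIV) (PiE UNIV (\<lambda>_ :: nat \<times> 'x. {0..1}))"
    by (simp add: compactin_PiE)
  then have "compact (PiE UNIV (\<lambda>_ :: nat \<times> 'x. {0..1::real}))"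
    by (simp add: euclidean_product_topology)
  then have "seq_compact (PiE UNIV (\<lambda>_ :: nat \<times> 'x. {0..1::real}))"
    by (rule compact_imp_seq_compact)
  moreover have "\<forall>n. F n \<in> PiE UNIV (\<lambda>_. {0..1})"
    by (auto simp: F_def pmf_le_1)
  ultimately obtain l r where r: "strict_mono (r :: nat \<Rightarrow> nat)" and l: "(F \<circ> r) \<longlonglongrightarrow> l"
    by (rule seq_compactE) blast
  have lim: "(\<lambda>n. pmf (M (r n) t) x) \<longlonglongrightarrow> l (t, x)" for t x
  proof -
    have "(\<lambda>n. (F \<circ> r) n (t, x)) \<longlonglongrightarrow> l (t, x)"
      by (rule continuous_on_tendsto_compose[OF continuous_on_product_coordinates l]) auto
    then show ?thesis
      by (simp add: F_def)
  qed
  have "\<exists>m. \<forall>x. pmf m x = l (t, x)" for t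
    using pmf_limit_ex[OF lim[of t]] by metis
  then obtain m where "\<And>t x. pmf (m t) x = l (t, x)"
    by metis
  then show thesis
    using r lim by (intro that[of r m]) auto
qed

lemma l1_dist_tendsto_0_iff:
  "(\<lambda>n. l1_dist (M n) m) \<longlonglongrightarrow> 0 \<longleftrightarrow> (\<forall>x. (\<lambda>n. pmf (M n) x) \<longlonglongrightarrow> pmf m x)"
proof safe
  fix x assume "(\<lambda>n. l1_dist (M n) m) \<longlonglongrightarrow> 0"
  then have "(\<lambda>n. pmf (M n) x - pmf m x) \<longlonglongrightarrow> 0"
    by (rule Lim_null_comparison[rotated]) (simp add: abs_pmf_diff_le_l1_dist)
  then show "(\<lambda>n. pmf (M n) x) \<longlonglongrightarrow> pmf m x"
    by (simp add: LIM_zero_iff)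
next
  assume "\<forall>x. (\<lambda>n. pmf (M n) x) \<longlonglongrightarrow> pmf m x"
  then have "(\<lambda>n. l1_dist (M n) m) \<longlonglongrightarrow> (\<Sum>x\<in>UNIV. \<bar>pmf m x - pmf m x\<bar>)"
    unfolding l1_dist_def by (intro tendsto_intros) auto
  then show "(\<lambda>n. l1_dist (M n) m) \<longlonglongrightarrow> 0"
    by simp
qed

lemma l1_dist_le_2: "l1_dist u v \<le> 2"
proof -
  have "l1_dist u v \<le> (\<Sum>a\<in>UNIV. pmf u a + pmf v a)"
    unfolding l1_dist_def by (intro sum_mono) (simp add: abs_le_iff add_increasing add_increasing2)
  then show ?thesis
    by (simp add: sum.distrib sum_pmf_eq_1)
qed

lemma tendsto_lipschitz:
  fixes f :: "'e \<Rightarrow> real"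
  assumes "\<And>u v. \<bar>f u - f v\<bar> \<le> B * d u v" "(\<lambda>n. d (s n) l) \<longlonglongrightarrow> (0 :: real)"
  shows "(\<lambda>n. f (s n)) \<longlonglongrightarrow> f l"
proof -
  have "(\<lambda>n. f (s n) - f l) \<longlonglongrightarrow> 0"
    by (rule Lim_null_comparison[OF _ tendsto_mult_right_zero[OF assms(2), of B]]) (simp add: assms(1))
  then show ?thesis
    by (simp add: LIM_zero_iff)
qed

lemma tendsto_sum_abs_diff_0:
  fixes w :: "nat \<Rightarrow> 'a::finite \<Rightarrow> real"
  assumes "\<And>a. (\<lambda>n. w n a) \<longlonglongrightarrow> l a"
  shows "(\<lambda>n. \<Sum>a\<in>UNIV. \<bar>w n a - l a\<bar>) \<longlonglongrightarrow> 0"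
proof -
  have "(\<lambda>n. \<Sum>a\<in>UNIV. \<bar>w n a - l a\<bar>) \<longlonglongrightarrow> (\<Sum>a\<in>UNIV. \<bar>l a - l a\<bar>)"
    by (intro tendsto_intros assms)
  then show ?thesis by simp
qed

section \<open>Continuity of the one-step maps in tables and state measures\<close>

context regularized_model
begin

lemma lipschitz_mean_field:
  "\<bar>c x a u - c x a v\<bar> \<le> L * l1_dist u v" "l1_dist (p x a u) (p x a v) \<le> K * l1_dist u v"
  using lipschitz[unfolded lipschitz_model_def, rule_format, of x a u x a v] by simp_all

lemma tendsto_cost:
  assumes "\<And>x. (\<lambda>n. pmf (M n) x) \<longlonglongrightarrow> pmf m x"
  shows "(\<lambda>n. c x a (M n)) \<longlonglongrightarrow> c x a m"
proof (rule tendsto_lipschitz[where f = "c x a", OF lipschitz_mean_field(1)])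
  show "(\<lambda>n. l1_dist (M n) m) \<longlonglongrightarrow> 0"
    using assms by (simp add: l1_dist_tendsto_0_iff)
qed

lemma tendsto_kernel:
  assumes "\<And>x. (\<lambda>n. pmf (M n) x) \<longlonglongrightarrow> pmf m x"
  shows "(\<lambda>n. pmf (p x a (M n)) y) \<longlonglongrightarrow> pmf (p x a m) y"
proof (rule tendsto_lipschitz[where f = "\<lambda>\<nu>. pmf (p x a \<nu>) y"])
  show "\<bar>pmf (p x a u) y - pmf (p x a v) y\<bar> \<le> K * l1_dist u v" for u v
    using abs_pmf_diff_le_l1_dist lipschitz_mean_field(2) by (rule order_trans)
  show "(\<lambda>n. l1_dist (M n) m) \<longlonglongrightarrow> 0"
    using assms by (simp add: l1_dist_tendsto_0_iff)
qed

lemma tendsto_val: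
  assumes "\<And>a. (\<lambda>n. w n a) \<longlonglongrightarrow> l a"
  shows "(\<lambda>n. val (w n)) \<longlonglongrightarrow> val l"
proof (rule tendsto_lipschitz[where f = val and B = 1 and
      d = "\<lambda>v v'. \<Sum>a\<in>UNIV. \<bar>v a - v' a\<bar>"])
  show "\<bar>val v - val v'\<bar> \<le> 1 * (\<Sum>a\<in>UNIV. \<bar>v a - v' a\<bar>)" for v v'
    using val_lipschitz by simp
  show "(\<lambda>n. \<Sum>a\<in>UNIV. \<bar>w n a - l a\<bar>) \<longlonglongrightarrow> 0"
    by (rule tendsto_sum_abs_diff_0[OF assms])
qed

lemma minimizer_tendsto:
  assumes "\<And>a. (\<lambda>n. w n a) \<longlonglongrightarrow> l a"
  shows "(\<lambda>n. l1_dist (minimizer (w n)) (minimizer l)) \<longlonglongrightarrow> 0"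
proof (rule Lim_null_comparison)
  show "\<forall>\<^sub>F n in sequentially. norm (l1_dist (minimizer (w n)) (minimizer l))
      \<le> 2 / \<rho> * (\<Sum>a\<in>UNIV. \<bar>w n a - l a\<bar>)"
    using minimizer_lipschitz by simp
  show "(\<lambda>n. 2 / \<rho> * (\<Sum>a\<in>UNIV. \<bar>w n a - l a\<bar>)) \<longlonglongrightarrow> 0"
    by (rule tendsto_mult_right_zero[OF tendsto_sum_abs_diff_0[OF assms]])
qed

lemma tendsto_backup:
  assumes "\<And>x a. (\<lambda>n. q n x a) \<longlonglongrightarrow> l x a" "\<And>x. (\<lambda>n. pmf (M n) x) \<longlonglongrightarrow> pmf m x"
  shows "(\<lambda>n. backup (q n) (M n) x a) \<longlonglongrightarrow> backup l m x a"
  unfolding backup_def by (intro tendsto_intros tendsto_cost tendsto_kernel tendsto_val assms)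

lemma tendsto_H2_det_policy:
  assumes q: "\<And>x a. (\<lambda>n. q n x a) \<longlonglongrightarrow> l x a" and M: "\<And>x. (\<lambda>n. pmf (M n) x) \<longlonglongrightarrow> pmf m x"
  shows "(\<lambda>n. pmf (H2 p (det_policy (q n)) (M n)) y) \<longlonglongrightarrow> pmf (H2 p (det_policy l) m) y"
proof -
  have "(\<lambda>n. pmf (minimizer (q n x)) a) \<longlonglongrightarrow> pmf (minimizer (l x)) a" for x a
    using minimizer_tendsto[of "\<lambda>n. q n x" "l x"] q by (simp add: l1_dist_tendsto_0_iff)
  then show ?thesis
    unfolding pmf_H2_det_policy pmf_mean_kernel by (intro tendsto_intros tendsto_kernel M)
qed

text \<open>Tables are computed from \<open>t\<close> to \<open>t + 1\<close> and measures from
  \<open>t + 1\<close> to \<open>t\<close>, so the two recursions run against each other. The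
  predicate concerns a single \<open>t\<close> because a horizon \<open>T\<close> supplies it only
  for \<open>t < T\<close>.\<close>

definition mean_field_flow :: "(nat \<Rightarrow> 'x \<Rightarrow> 'a \<Rightarrow> real) \<Rightarrow> (nat \<Rightarrow> 'x pmf) \<Rightarrow> nat \<Rightarrow> bool"
  where "mean_field_flow q \<mu> t \<longleftrightarrow>
    q (Suc t) = backup (q t) (\<mu> (Suc t)) \<and> \<mu> t = H2 p (det_policy (q (Suc t))) (\<mu> (Suc t))"

lemma TRMFE_det_policyI:
  assumes "\<And>t. mean_field_flow q \<mu> t"
  shows "(\<lambda>t. det_policy (q t), \<mu>) \<in> TRMFE c p \<Omega> \<rho> \<beta> (\<lambda>x. reg (q 0 x))"
proof -
  have "(\<lambda>x. reg (q (Suc t) x)) = H1 c p \<Omega> \<rho> \<beta> (\<lambda>x. reg (q t x)) (\<mu> (Suc t))"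
    "\<mu> t = H2 p (det_policy (q (Suc t))) (\<mu> (Suc t))" for t
    using assms[of t] unfolding mean_field_flow_def H1_reg by auto
  then show ?thesis
    unfolding TRMFE_def using is_policy_det_policy greedy_det_policy
    by (intro CollectI case_prodI conjI exI[of _ "\<lambda>t x. reg (q t x)"] allI refl)
qed

lemma MFE_det_policyE:
  assumes MFE: "(\<pi>, \<mu>) \<in> MFE c p \<Omega> \<rho> \<beta> T \<mu>init (\<lambda>x. reg (q0 x))"
  obtains q where "q 0 = q0" "\<And>t. t < T \<Longrightarrow> mean_field_flow q \<mu> t"
    "\<And>t. t \<le> T \<Longrightarrow> \<pi> t = det_policy (q t)"
proof -
  obtain Q where Q0: "Q 0 = (\<lambda>x. reg (q0 x))"
    and Q: "\<And>t. t < T \<Longrightarrow> Q (Suc t) = H1 c p \<Omega> \<rho> \<beta> (Q t) (\<mu> (Suc t))"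
    and \<mu>: "\<And>t. t < T \<Longrightarrow> \<mu> t = H2 p (\<pi> (Suc t)) (\<mu> (Suc t))"
    and \<pi>: "\<And>t. t \<le> T \<Longrightarrow> is_policy (\<pi> t)" "\<And>t. t \<le> T \<Longrightarrow> greedy (\<pi> t) (Q t)"
    using MFE unfolding MFE_def by auto
  \<comment> \<open>The recursion runs on for all \<open>t\<close>, whereas \<open>Q\<close> is
    constrained only up to \<open>T\<close>; the two are compared for
    \<open>t \<le> T\<close>.\<close>
  define q where "q = rec_nat q0 (\<lambda>t w. backup w (\<mu> (Suc t)))"
  have q_simps: "q 0 = q0" "q (Suc t) = backup (q t) (\<mu> (Suc t))" for t
    by (simp_all add: q_def)
  have "t \<le> T \<Longrightarrow> Q t = (\<lambda>x. reg (q t x))" for t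
    by (induction t) (simp_all add: Q0 Q q_simps H1_reg)
  then have "t \<le> T \<Longrightarrow> \<pi> t = det_policy (q t)" for t
    using \<pi> by (intro greedy_imp_det_policy) auto
  moreover have "mean_field_flow q \<mu> t" if "t < T" for t
    using calculation[of "Suc t"] \<mu>[OF that] that by (simp add: mean_field_flow_def q_simps)
  ultimately show thesis
    using q_simps(1) that by blast
qed

text \<open>Repeating time $0$ gives another equilibrium with the same terminal function.\<close>

lemma flow_stationary_if_unique:
  assumes flow: "\<And>t. mean_field_flow q \<mu> t" and fixpoint: "q 0 = backup (q 0) (\<mu> 0)"
    and unique: "\<exists>!F. F \<in> TRMFE c p \<Omega> \<rho> \<beta> (\<lambda>x. reg (q 0 x))"
  shows "\<mu> 0 = H2 p (det_policy (q 0)) (\<mu> 0)"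
proof -
  \<comment> \<open>Both \<open>q' 0\<close> and \<open>q' 1\<close> are \<open>q 0\<close>, so the
    flow equations at index 0 are the fixed point equation and the definition of
    \<open>\<mu>' 0\<close>; the later ones are those of the given flow, shifted by one.\<close>
  define q' where "q' = case_nat (q 0) q"
  define \<mu>' where "\<mu>' = case_nat (H2 p (det_policy (q 0)) (\<mu> 0)) \<mu>"
  have "mean_field_flow q' \<mu>' t" for t
  proof (cases t)
    case 0
    then show ?thesis
      using fixpoint by (simp add: mean_field_flow_def q'_def \<mu>'_def)
  next
    case (Suc k)
    then show ?thesis
      using flow[of k] by (simp add: mean_field_flow_def q'_def \<mu>'_def)
  qed
  then have "(\<lambda>t. det_policy (q' t), \<mu>') \<in> TRMFE c p \<Omega> \<rho> \<beta> (\<lambda>x. reg (q 0 x))"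
    using TRMFE_det_policyI[of q' \<mu>'] by (simp add: q'_def)
  moreover have "(\<lambda>t. det_policy (q t), \<mu>) \<in> TRMFE c p \<Omega> \<rho> \<beta> (\<lambda>x. reg (q 0 x))"
    using flow by (rule TRMFE_det_policyI)
  ultimately have "\<mu>' = \<mu>"
    using unique by blast
  then show ?thesis
    by (metis \<mu>'_def old.nat.simps(4))
qed

text \<open>Convergence is assumed at time 0 only. Measures at the other times come from compactness
  along a subsequence \<open>r\<close>, which leaves no trace in the conclusion because
  \<open>m\<close> is already fixed by \<open>d\<close>.\<close>

lemma limit_stationary:
  assumes T: "filterlim T at_top sequentially"
    and flow: "\<And>n t. t < T n \<Longrightarrow> mean_field_flow (q n) (\<mu> n) t"
    and fixpoint: "\<And>n. q n 0 = backup (q n 0) (\<mu> n 0)"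
    and q_lim: "\<And>x a. (\<lambda>n. q n 0 x a) \<longlonglongrightarrow> l x a"
    and \<mu>_lim: "\<And>x. (\<lambda>n. pmf (\<mu> n 0) x) \<longlonglongrightarrow> d x"
    and unique: "\<exists>!F. F \<in> TRMFE c p \<Omega> \<rho> \<beta> (\<lambda>x. reg (l x))"
  obtains m where "\<And>x. pmf m x = d x" "l = backup l m" "m = H2 p (det_policy l) m"
proof -
  obtain r m where r: "strict_mono (r :: nat \<Rightarrow> nat)"
    and m: "\<And>t x. (\<lambda>n. pmf (\<mu> (r n) t) x) \<longlonglongrightarrow> pmf (m t) x"
    using pmf_seq_compact[of \<mu>] by blast
  define w where "w = rec_nat l (\<lambda>t v. backup v (m (Suc t)))"
  have w_simps: "w 0 = l" "w (Suc t) = backup (w t) (m (Suc t))" for t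
    by (simp_all add: w_def)
  \<comment> \<open>At each fixed \<open>t\<close> the flow equations hold for all but finitely many
    \<open>n\<close>, which suffices to pass to the limit in them.\<close>
  have T_r: "\<forall>\<^sub>F n in sequentially. t < T (r n)" for t
    using filterlim_compose[OF T filterlim_subseq[OF r]] unfolding filterlim_at_top Suc_le_eq[symmetric] by blast
  \<comment> \<open>Only the measures need compactness: the tables at time 0 converge by assumption,
    and continuity of \<open>backup\<close> carries this from \<open>t\<close> to
    \<open>Suc t\<close>.\<close>
  have w: "(\<lambda>n. q (r n) t x a) \<longlonglongrightarrow> w t x a" for t x a
  proof (induction t arbitrary: x a)
    case 0
    then show ?case
      using LIMSEQ_subseq_LIMSEQ[OF q_lim r] by (simp add: w_simps o_def)
  next
    case (Suc t)
    have "(\<lambda>n. backup (q (r n) t) (\<mu> (r n) (Suc t)) x a) \<longlonglongrightarrow> w (Suc t) x a"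
      unfolding w_simps by (intro tendsto_backup Suc m)
    moreover have "\<forall>\<^sub>F n in sequentially. backup (q (r n) t) (\<mu> (r n) (Suc t)) x a = q (r n) (Suc t) x a"
      using T_r[of t] by eventually_elim (simp add: flow[unfolded mean_field_flow_def])
    ultimately show ?case
      by (rule Lim_transform_eventually)
  qed
  have m_rec: "m t = H2 p (det_policy (w (Suc t))) (m (Suc t))" for t
  proof (rule pmf_eqI)
    fix y
    have "(\<lambda>n. pmf (H2 p (det_policy (q (r n) (Suc t))) (\<mu> (r n) (Suc t))) y)
        \<longlonglongrightarrow> pmf (H2 p (det_policy (w (Suc t))) (m (Suc t))) y"
      by (intro tendsto_H2_det_policy w m)
    moreover have "\<forall>\<^sub>F n in sequentially.
        pmf (H2 p (det_policy (q (r n) (Suc t))) (\<mu> (r n) (Suc t))) y = pmf (\<mu> (r n) t) y"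
      using T_r[of t] by eventually_elim (metis flow mean_field_flow_def)
    ultimately have "(\<lambda>n. pmf (\<mu> (r n) t) y) \<longlonglongrightarrow> pmf (H2 p (det_policy (w (Suc t))) (m (Suc t))) y"
      by (rule Lim_transform_eventually)
    then show "pmf (m t) y = pmf (H2 p (det_policy (w (Suc t))) (m (Suc t))) y"
      by (rule LIMSEQ_unique[OF m])
  qed
  have flow_m: "mean_field_flow w m t" for t
    unfolding mean_field_flow_def by (intro conjI w_simps(2) m_rec)
  have l_eq: "l = backup l (m 0)"
  proof (intro ext)
    fix x a
    have "(\<lambda>n. backup (q (r n) 0) (\<mu> (r n) 0) x a) \<longlonglongrightarrow> backup l (m 0) x a"
      by (rule tendsto_backup[OF w[of 0, unfolded w_simps(1)] m])
    then have "(\<lambda>n. q (r n) 0 x a) \<longlonglongrightarrow> backup l (m 0) x a"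
      unfolding fixpoint[symmetric] .
    with w[of 0 x a] show "l x a = backup l (m 0) x a"
      unfolding w_simps(1) by (rule LIMSEQ_unique)
  qed
  show thesis
  proof (rule that[of "m 0"])
    show "pmf (m 0) x = d x" for x
      using LIMSEQ_unique[OF m[of 0 x]] LIMSEQ_subseq_LIMSEQ[OF \<mu>_lim r] by (simp add: o_def)
    show "m 0 = H2 p (det_policy l) (m 0)"
      by (rule flow_stationary_if_unique[OF flow_m, unfolded w_simps(1), OF l_eq unique])
  qed (rule l_eq)
qed

end

subsection \<open>Weak accumulation points\<close>

lemma continuous_map_weak_topology_integral:
  assumes f: "f \<in> bounded_continuous T"
  shows "continuous_map (weak_topology T) euclideanreal (\<lambda>N. \<integral>z. f z \<partial>N)"
proof -
  let ?\<Phi> = "\<lambda>N. \<lambda>f\<in>bounded_continuous T. \<integral>z. f z \<partial>N"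
  have "continuous_map (weak_topology T) euclideanreal ((\<lambda>h. h f) \<circ> ?\<Phi>)"
    unfolding weak_topology_def
    by (rule continuous_map_pullback) (rule continuous_map_product_projection[OF f])
  moreover have "(\<lambda>h. h f) \<circ> ?\<Phi> = (\<lambda>N. \<integral>z. f z \<partial>N)"
    using f by auto
  ultimately show ?thesis by simp
qed

lemma topspace_weak_topology: "topspace (weak_topology T) = prob_measures T"
  by (auto simp: weak_topology_def topspace_pullback_topology)

text \<open>Finitely many tests merge into one continuous function \<open>\<Psi>\<close>, the sum of
  their deviations. Each set where \<open>\<Psi>\<close> is below \<open>1 / (k + 1)\<close> is thus
  a neighbourhood of \<open>N\<close> visited infinitely often, and increasing indices can be chosen
  in turn.\<close>

lemma accumulation_point_weak_subseq:
  assumes acc: "accumulation_point (weak_topology T) s N"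
    and F: "finite F" "F \<subseteq> bounded_continuous T"
  obtains r where "strict_mono (r :: nat \<Rightarrow> nat)"
    "\<And>f. f \<in> F \<Longrightarrow> (\<lambda>n. \<integral>z. f z \<partial>s (r n)) \<longlonglongrightarrow> (\<integral>z. f z \<partial>N)"
proof -
  define \<Psi> where "\<Psi> N' = (\<Sum>f\<in>F. \<bar>(\<integral>z. f z \<partial>N') - (\<integral>z. f z \<partial>N)\<bar>)" for N'
  have \<Psi>: "continuous_map (weak_topology T) euclideanreal \<Psi>"
    unfolding \<Psi>_def
    by (intro continuous_map_sum F continuous_map_real_abs continuous_map_diff
        continuous_map_weak_topology_integral continuous_map_const[THEN iffD2])
      (use F in auto)
  have often: "\<exists>\<^sub>\<infinity>n. \<Psi> (s n) < e" if "0 < e" for e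
  proof -
    let ?U = "{N' \<in> topspace (weak_topology T). \<Psi> N' \<in> {..<e}}"
    have "openin (weak_topology T) ?U"
      by (rule openin_continuous_map_preimage[OF \<Psi>]) simp
    moreover have "N \<in> ?U"
      using acc that by (simp add: accumulation_point_def \<Psi>_def)
    ultimately have "\<exists>\<^sub>\<infinity>n. s n \<in> ?U"
      using acc unfolding accumulation_point_def by blast
    then show ?thesis
      by (rule INFM_mono) simp
  qed
  have "\<exists>r. \<forall>k. \<Psi> (s (r k)) < 1 / real (Suc k) \<and> r k < r (Suc k)"
  proof (rule dependent_nat_choice)
    show "\<exists>n. \<Psi> (s n) < 1 / real (Suc 0)"
      using often[of 1] by (auto simp: INFM_nat)
    show "\<exists>n'. \<Psi> (s n') < 1 / real (Suc (Suc k)) \<and> n < n'" for n k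
      using often[of "1 / real (Suc (Suc k))"] by (auto simp: INFM_nat)
  qed
  then obtain r where r: "\<And>k. \<Psi> (s (r k)) < 1 / real (Suc k)" "\<And>k. r k < r (Suc k)"
    by blast
  show thesis
  proof (rule that)
    show "strict_mono r"
      using r(2) by (simp add: strict_mono_Suc_iff)
    fix f assume f: "f \<in> F"
    have "(\<lambda>n. (\<integral>z. f z \<partial>s (r n)) - (\<integral>z. f z \<partial>N)) \<longlonglongrightarrow> 0"
    proof (rule Lim_null_comparison[OF always_eventually LIMSEQ_Suc[OF lim_1_over_n]], rule allI)
      fix n
      have "\<bar>(\<integral>z. f z \<partial>s (r n)) - (\<integral>z. f z \<partial>N)\<bar> \<le> \<Psi> (s (r n))"
        unfolding \<Psi>_def by (rule member_le_sum[OF f]) (use F in auto)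
      then show "norm ((\<integral>z. f z \<partial>s (r n)) - (\<integral>z. f z \<partial>N)) \<le> 1 / of_nat (Suc n)"
        using r(1)[of n] by simp
    qed
    then show "(\<lambda>n. \<integral>z. f z \<partial>s (r n)) \<longlonglongrightarrow> (\<integral>z. f z \<partial>N)"
      by (simp add: LIM_zero_iff)
  qed
qed

text \<open>Continuous because the states are discrete; its integrals give the state
  marginal.\<close>

definition state_test :: "'x \<Rightarrow> 'x \<times> 'a::finite pmf \<Rightarrow> real"
  where "state_test x z = of_bool (fst z = x)"

text \<open>Continuous for every \<open>h\<close>, at most 2, and zero exactly on the graph of
  \<open>h\<close>, so a vanishing integral confines a measure to that graph.\<close>

definition graph_test :: "('x \<Rightarrow> 'a::finite pmf) \<Rightarrow> 'x \<times> 'a pmf \<Rightarrow> real"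
  where "graph_test h z = l1_dist (snd z) (h (fst z))"

lemma state_test_bounded_continuous:
  "state_test x \<in> bounded_continuous state_action_topology"
  unfolding bounded_continuous_def
  by (auto simp: state_test_def bounded_iff intro!: continuous_map_state_action exI[of _ 1])

lemma graph_test_bounded_continuous:
  "graph_test h \<in> bounded_continuous state_action_topology"
  unfolding bounded_continuous_def
  by (auto simp: graph_test_def bounded_iff l1_dist_le_2
      intro!: continuous_map_state_action continuous_map_l1_dist exI[of _ 2])

section \<open>Recognizing a joint law by its tests\<close>

context regularized_model
begin

lemma integral_joint_law_det_policy:
  assumes f: "f \<in> borel_measurable (borel_of state_action_topology)" and B: "\<And>z. \<bar>f z\<bar> \<le> B"
  shows "(\<integral>z. f z \<partial>joint_law (det_policy q) \<mu>) = (\<Sum>x\<in>UNIV. pmf \<mu> x * f (x, minimizer (q x)))"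
  unfolding integral_joint_law[OF is_policy_det_policy f B]
  by (subst integral_det_policy[OF measurable_compose[OF measurable_Pair_state_action f]]) simp

text \<open>This makes the disintegration explicit: a probability measure carried by the graph of
  the minimizer is determined by its state marginal.\<close>

lemma eq_joint_law_det_policyI:
  assumes \<Lambda>: "\<Lambda> \<in> prob_measures state_action_topology"
    and graph: "(\<integral>z. graph_test (\<lambda>x. minimizer (q x)) z \<partial>\<Lambda>) = 0"
    and state: "\<And>x. (\<integral>z. state_test x z \<partial>\<Lambda>) = pmf m x"
  shows "\<Lambda> = joint_law (det_policy q) m"
proof -
  let ?h = "\<lambda>x. minimizer (q x)"
  interpret \<Lambda>: prob_space \<Lambda>
    by (rule in_prob_measuresD(1)[OF \<Lambda>])
  interpret J: prob_space "joint_law (det_policy q) m"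
    by (rule prob_space_joint_law[OF is_policy_det_policy])
  note sets = in_prob_measuresD(2)[OF \<Lambda>]
  have integrable: "integrable \<Lambda> f" if "f \<in> bounded_continuous state_action_topology" for f
  proof -
    have "\<exists>B. \<forall>z. \<bar>f z\<bar> \<le> B"
      using that unfolding bounded_continuous_def by (auto simp: bounded_iff image_iff)
    then obtain B where "\<And>z. \<bar>f z\<bar> \<le> B"
      by blast
    moreover have "f \<in> borel_measurable \<Lambda>"
      using that unfolding bounded_continuous_def measurable_cong_sets[OF sets refl]
      by (auto intro: continuous_map_borel_measurable)
    ultimately show ?thesis
      by (intro \<Lambda>.integrable_const_bound[of _ B]) auto
  qed
  have "AE z in \<Lambda>. 0 \<le> graph_test ?h z"
    by (simp add: graph_test_def)
  from integral_nonneg_eq_0_iff_AE[OF integrable[OF graph_test_bounded_continuous] this] graph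
  have "AE z in \<Lambda>. graph_test ?h z = 0"
    by blast
  then have AE: "AE z in \<Lambda>. snd z = ?h (fst z)"
    by eventually_elim (simp add: graph_test_def)
  show ?thesis
  proof (rule measure_eqI)
    show "sets \<Lambda> = sets (joint_law (det_policy q) m)"
      by (simp add: sets)
    fix B assume B: "B \<in> sets \<Lambda>"
    then have ind: "indicat_real B \<in> borel_measurable (borel_of state_action_topology)"
      by (simp add: sets)
    have "measure \<Lambda> B = (\<integral>z. indicat_real B z \<partial>\<Lambda>)"
      using B by simp
    \<comment> \<open>On the graph, membership in \<open>B\<close> depends on the state alone, so
      the indicator of \<open>B\<close> is almost everywhere a finite combination of the functions
      \<open>state_test x\<close>.\<close>
    also have "\<dots> = (\<integral>z. (\<Sum>x\<in>UNIV. indicator B (x, ?h x) * state_test x z) \<partial>\<Lambda>)"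
    proof (rule integral_cong_AE)
      show "(\<lambda>z. \<Sum>x\<in>UNIV. indicator B (x, ?h x) * state_test x z) \<in> borel_measurable \<Lambda>"
        using integrable[OF state_test_bounded_continuous] by simp
      show "AE z in \<Lambda>. indicator B z = (\<Sum>x\<in>UNIV. indicator B (x, ?h x) * state_test x z)"
        using AE
      proof eventually_elim
        case (elim z)
        then have "z = (fst z, ?h (fst z))"
          by (metis prod.collapse)
        then show ?case
          by (simp add: state_test_def of_bool_def if_distrib[of "\<lambda>t. _ * t"] sum.delta' cong: if_cong)
      qed
    qed (use B in simp)
    also have "\<dots> = (\<Sum>x\<in>UNIV. indicator B (x, ?h x) * pmf m x)"
      using integrable[OF state_test_bounded_continuous] by (simp add: state)
    also have "\<dots> = (\<integral>z. indicat_real B z \<partial>joint_law (det_policy q) m)"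
      by (subst integral_joint_law_det_policy[OF ind, of 1]) (auto simp: mult.commute)
    also have "\<dots> = measure (joint_law (det_policy q) m) B"
      using B by (simp add: sets)
    finally show "emeasure \<Lambda> B = emeasure (joint_law (det_policy q) m) B"
      by (simp add: \<Lambda>.emeasure_eq_measure J.emeasure_eq_measure)
  qed
qed

lemma C_spaceE:
  assumes "Q \<in> C_space c \<Omega> \<rho> \<beta> L K"
  obtains q where "Q = (\<lambda>x. reg (q x))"
  using assms unfolding C_space_def reg_def by (auto simp: fun_eq_iff)

text \<open>Uniform closeness is evaluated at the vertices, where \<Omega> cancels and a single
  table entry is left.\<close>

lemma limitin_C_topologyD:
  assumes lim: "limitin (C_topology c \<Omega> \<rho> \<beta> L K) (\<lambda>n x. reg (q n x)) (\<lambda>x. reg (l x)) sequentially"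
  shows "(\<lambda>n. q n x a) \<longlonglongrightarrow> l x a"
proof -
  let ?Q = "\<lambda>n x. reg (q n x)" and ?Ql = "\<lambda>x. reg (l x)"
  interpret C: Metric_space "C_space c \<Omega> \<rho> \<beta> L K" sup_dist
    by (rule Metric_space_C_space)
  have lim': "?Ql \<in> C_space c \<Omega> \<rho> \<beta> L K \<and> (\<forall>e>0. \<exists>N. \<forall>n\<ge>N. ?Q n \<in> C_space c \<Omega> \<rho> \<beta> L K \<and> sup_dist (?Q n) ?Ql < e)"
    using lim unfolding C_topology_def C.limit_metric_sequentially .
  have vertex: "reg w (return_pmf a) = w a + \<rho> * \<Omega> (return_pmf a)" for w
    by (simp add: reg_def indicator_def if_distrib[of "\<lambda>t. _ * t"] sum.delta cong: if_cong)
  have le: "\<bar>q n x a - l x a\<bar> \<le> sup_dist (?Q n) ?Ql" if "?Q n \<in> C_space c \<Omega> \<rho> \<beta> L K" for n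
  proof -
    \<comment> \<open>Both functions lie in \<open>C_space\<close>, so \<open>sup_dist\<close> is a
      true supremum here and not its default value 0.\<close>
    have "bdd_above (range (\<lambda>(x, u). \<bar>?Q n x u - ?Ql x u\<bar>))"
      using that lim' by (intro C_space_diff_bounded) auto
    then have "\<bar>?Q n x (return_pmf a) - ?Ql x (return_pmf a)\<bar> \<le> sup_dist (?Q n) ?Ql"
      using cSUP_upper[OF UNIV_I, of "\<lambda>(x, u). \<bar>?Q n x u - ?Ql x u\<bar>" "(x, return_pmf a)"]
      by (simp add: sup_dist_def)
    then show ?thesis
      by (simp add: vertex)
  qed
  show ?thesis
  proof (rule LIMSEQ_I)
    fix e :: real assume "0 < e"
    then obtain N where N: "\<And>n. N \<le> n \<Longrightarrow> ?Q n \<in> C_space c \<Omega> \<rho> \<beta> L K \<and> sup_dist (?Q n) ?Ql < e"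
      using lim' by blast
    have "norm (q n x a - l x a) < e" if "N \<le> n" for n
      using le[of n] N[OF that] by simp
    then show "\<exists>N. \<forall>n\<ge>N. norm (q n x a - l x a) < e"
      by blast
  qed
qed

end

theorem theorem4:
  fixes c :: "('x::finite, 'a::finite) cost"
    and p :: "('x, 'a) kernel"
    and \<Omega> :: "'a pmf \<Rightarrow> real"
    and \<rho> \<beta> L\<^sub>1 K\<^sub>1 :: real
    and \<mu>init :: "'x pmf"
    and Q\<^sub>0 :: "nat \<Rightarrow> ('x, 'a) qfun"
    and \<pi> :: "nat \<Rightarrow> nat \<Rightarrow> ('x, 'a) policy"
    and \<mu> :: "nat \<Rightarrow> nat \<Rightarrow> 'x pmf"
    and Qstar :: "('x, 'a) qfun"
    and Tn :: "nat \<Rightarrow> nat"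
    and \<Lambda> :: "('x \<times> 'a pmf) measure"
  assumes "0 < \<beta>" and "\<beta> < 1" and "0 < \<rho>"
    and "\<And>x a \<nu>. 0 \<le> c x a \<nu>"
    and "l1_strongly_convex \<Omega>"
    and "\<And>w :: 'a \<Rightarrow> real.
      \<exists>!u. is_arg_min (\<lambda>u. (\<Sum>a\<in>UNIV. w a * pmf u a) + \<rho> * \<Omega> u) (\<lambda>_. True) u"
    and "lipschitz_model c p L\<^sub>1 K\<^sub>1"
    and "\<beta> * K\<^sub>1 < 2"
    and "\<And>T. Q\<^sub>0 T \<in> C_space c \<Omega> \<rho> \<beta> L\<^sub>1 K\<^sub>1"
    and "\<And>T. (\<pi> T, \<mu> T) \<in> MFE c p \<Omega> \<rho> \<beta> T \<mu>init (Q\<^sub>0 T)"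
    and "\<And>T. Q\<^sub>0 T = H1 c p \<Omega> \<rho> \<beta> (Q\<^sub>0 T) (\<mu> T 0)"
    and "accumulation_point (C_topology c \<Omega> \<rho> \<beta> L\<^sub>1 K\<^sub>1) Q\<^sub>0 Qstar"
    and "\<And>Qterm. Qterm \<in> C_space c \<Omega> \<rho> \<beta> L\<^sub>1 K\<^sub>1 \<Longrightarrow> \<exists>!F. F \<in> TRMFE c p \<Omega> \<rho> \<beta> Qterm"
    and "filterlim Tn at_top sequentially"
    and "limitin (C_topology c \<Omega> \<rho> \<beta> L\<^sub>1 K\<^sub>1) (\<lambda>n. Q\<^sub>0 (Tn n)) Qstar sequentially"
    and "accumulation_point (weak_topology state_action_topology)
      (\<lambda>n. joint_law (\<pi> (Tn n) 0) (\<mu> (Tn n) 0)) \<Lambda>"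
  shows "\<exists>\<pi>stat \<mu>stat. stationary_MFE c p \<Omega> \<rho> \<beta> \<pi>stat \<mu>stat \<and> \<Lambda> = joint_law \<pi>stat \<mu>stat"
proof -
  interpret regularized_model c p \<Omega> \<rho> \<beta> L\<^sub>1 K\<^sub>1
    by (rule regularized_model.intro) (fact assms)+
  interpret C: Metric_space "C_space c \<Omega> \<rho> \<beta> L\<^sub>1 K\<^sub>1" sup_dist
    by (rule Metric_space_C_space)
  have "\<exists>q. Q\<^sub>0 T = (\<lambda>x. reg (q x))" for T
    using C_spaceE[OF assms(9)] by metis
  then obtain q\<^sub>0 where q\<^sub>0: "\<And>T. Q\<^sub>0 T = (\<lambda>x. reg (q\<^sub>0 T x))"
    by metis
  have Qstar: "Qstar \<in> C_space c \<Omega> \<rho> \<beta> L\<^sub>1 K\<^sub>1"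
    using limitin_topspace[OF assms(15)] by (simp add: C_topology_def)
  then obtain l where l: "Qstar = (\<lambda>x. reg (l x))"
    by (rule C_spaceE)
  have "\<exists>q. q 0 = q\<^sub>0 T \<and> (\<forall>t<T. mean_field_flow q (\<mu> T) t) \<and> (\<forall>t\<le>T. \<pi> T t = det_policy (q t))" for T
    using MFE_det_policyE[OF assms(10)[of T, unfolded q\<^sub>0]] by metis
  then obtain q where q: "\<And>T. q T 0 = q\<^sub>0 T" "\<And>T t. t < T \<Longrightarrow> mean_field_flow (q T) (\<mu> T) t"
    "\<And>T t. t \<le> T \<Longrightarrow> \<pi> T t = det_policy (q T t)"
    by metis
  have fixpoint: "q T 0 = backup (q T 0) (\<mu> T 0)" for T
    using assms(11)[of T] unfolding q\<^sub>0 q(1) H1_reg reg_inject .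
  have q_lim: "(\<lambda>n. q (Tn n) 0 x a) \<longlonglongrightarrow> l x a" for x a
    unfolding q(1) by (rule limitin_C_topologyD) (use assms(15) in \<open>simp only: q\<^sub>0 l\<close>)
  let ?h = "\<lambda>x. minimizer (l x)"
  let ?J = "\<lambda>n. joint_law (\<pi> (Tn n) 0) (\<mu> (Tn n) 0)"
  have J: "?J n = joint_law (det_policy (q (Tn n) 0)) (\<mu> (Tn n) 0)" for n
    by (simp add: q(3))
  \<comment> \<open>One subsequence for all tests: the states, and the distance to the graph of the
    minimizer that belongs to the limit table \<open>l\<close> and hence does not vary with
    \<open>n\<close>.\<close>
  obtain r where r: "strict_mono (r :: nat \<Rightarrow> nat)"
    and r_lim: "\<And>f. f \<in> insert (graph_test ?h) (range state_test) \<Longrightarrow>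
      (\<lambda>n. \<integral>z. f z \<partial>?J (r n)) \<longlonglongrightarrow> (\<integral>z. f z \<partial>\<Lambda>)"
  proof -
    have "finite (insert (graph_test ?h) (range state_test))"
      "insert (graph_test ?h) (range state_test) \<subseteq> bounded_continuous state_action_topology"
      using state_test_bounded_continuous graph_test_bounded_continuous by auto
    from accumulation_point_weak_subseq[OF assms(16) this] that show thesis
      by blast
  qed
  have bc_meas: "f \<in> borel_measurable (borel_of state_action_topology)"
    if "f \<in> bounded_continuous state_action_topology" for f :: "'x \<times> 'a pmf \<Rightarrow> real"
    using that by (auto simp: bounded_continuous_def intro: continuous_map_borel_measurable)
  have J_state: "(\<integral>z. state_test x z \<partial>?J n) = pmf (\<mu> (Tn n) 0) x" for x n
    unfolding J
    by (subst integral_joint_law_det_policy[OF bc_meas[OF state_test_bounded_continuous], of _ 1])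
      (auto simp: state_test_def of_bool_def if_distrib[of "\<lambda>t. _ * t"] sum.delta cong: if_cong)
  have J_graph: "(\<integral>z. graph_test ?h z \<partial>?J n)
      = (\<Sum>x\<in>UNIV. pmf (\<mu> (Tn n) 0) x * l1_dist (minimizer (q (Tn n) 0 x)) (?h x))" for n
    unfolding J
    by (subst integral_joint_law_det_policy[OF bc_meas[OF graph_test_bounded_continuous], of _ 2])
      (auto simp: graph_test_def l1_dist_le_2)
  \<comment> \<open>The law \<open>?J n\<close> sits on the graph of the minimizers of
    \<open>q (Tn n) 0\<close>, and these converge to \<open>?h\<close>. The integrals thus tend to 0
    along the whole sequence, while they are known to approach the integral under
    \<open>\<Lambda>\<close> only along \<open>r\<close>.\<close>
  have graph: "(\<integral>z. graph_test ?h z \<partial>\<Lambda>) = 0"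
  proof -
    have "(\<lambda>n. \<Sum>x\<in>UNIV. l1_dist (minimizer (q (Tn n) 0 x)) (?h x)) \<longlonglongrightarrow> (\<Sum>x\<in>(UNIV :: 'x set). 0)"
      by (intro tendsto_sum minimizer_tendsto q_lim)
    then have "(\<lambda>n. \<Sum>x\<in>UNIV. l1_dist (minimizer (q (Tn n) 0 x)) (?h x)) \<longlonglongrightarrow> 0"
      by simp
    then have "(\<lambda>n. \<integral>z. graph_test ?h z \<partial>?J n) \<longlonglongrightarrow> 0"
    proof (rule Lim_null_comparison[rotated])
      have "norm (\<integral>z. graph_test ?h z \<partial>?J n) \<le> (\<Sum>x\<in>UNIV. l1_dist (minimizer (q (Tn n) 0 x)) (?h x))" for n
        unfolding J_graph real_norm_def
        by (rule order_trans[OF sum_abs sum_mono]) (simp add: abs_mult mult_right_le_one_le pmf_le_1 mult_left_le_one_le)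
      then show "\<forall>\<^sub>F n in sequentially. norm (\<integral>z. graph_test ?h z \<partial>?J n)
          \<le> (\<Sum>x\<in>UNIV. l1_dist (minimizer (q (Tn n) 0 x)) (?h x))"
        by simp
    qed
    from LIMSEQ_subseq_LIMSEQ[OF this r] show ?thesis
      using LIMSEQ_unique[OF r_lim] by (simp add: o_def)
  qed
  have state: "(\<lambda>n. pmf (\<mu> (Tn (r n)) 0) x) \<longlonglongrightarrow> (\<integral>z. state_test x z \<partial>\<Lambda>)" for x
    using r_lim[of "state_test x"] by (simp add: J_state)
  have "\<exists>!F. F \<in> TRMFE c p \<Omega> \<rho> \<beta> (\<lambda>x. reg (l x))"
    using assms(13)[OF Qstar] by (simp only: l)
  \<comment> \<open>The state laws are known to converge along \<open>r\<close> only, so the flows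
    are taken at the horizons \<open>Tn (r n)\<close>, which still tend to infinity.\<close>
  then obtain m where m: "\<And>x. pmf m x = (\<integral>z. state_test x z \<partial>\<Lambda>)"
    and stat: "l = backup l m" "m = H2 p (det_policy l) m"
    using limit_stationary[where T = "\<lambda>n. Tn (r n)" and q = "\<lambda>n. q (Tn (r n))" and \<mu> = "\<lambda>n. \<mu> (Tn (r n))",
        OF filterlim_compose[OF assms(14) filterlim_subseq[OF r]] q(2) fixpoint
          LIMSEQ_subseq_LIMSEQ[OF q_lim r, unfolded o_def] state]
    by blast
  have "\<Lambda> \<in> prob_measures state_action_topology"
    using assms(16) by (simp add: accumulation_point_def topspace_weak_topology)
  then have "\<Lambda> = joint_law (det_policy l) m"
    using graph m by (intro eq_joint_law_det_policyI) simp_all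
  then show ?thesis
    using stationary_MFE_det_policy[OF stat] by blast
qed

end
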